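(* Let $(X,S)$ be an infinite minimal subshift. Then $(X,S)$ has finite topological rank if and only if $K(X)$ is finite, where $$K(X)=\lim_{n\to+\infty}\ \inf\Big\{|\mathcal W| : \mathcal W\subset\bigcup_{k\ge n}\mathcal L_k(X)\ \text{finite and recognizable in } X\Big\}$$ (the infimum over the empty set being $+\infty$).
   Context: $S$ is the shift map; $\mathcal L_k(X)$ is the set of words of length $k$ occurring in elements of the subshift $X$. Recognizable sets of words. A non-erasing morphism $\tau:\mathcal A^*\to\mathcal B^*$ (extended to $\mathcal A^{\mathbb Z}$ by concatenation, with $\tau(y_0)$ starting at coordinate $0$) is recognizable in $Y\subseteq\mathcal A^{\mathbb Z}$ if every $x\in\mathcal B^{\mathbb Z}$ has at most one pair $(k,y)$ with $y\in Y$, $0\le k<|\tau(y_0)|$ and $x=S^k\tau(y)$. A finite set $\mathcal W\subset\mathcal B^*$ of non-empty words is recognizable in a subshift $X\subseteq\mathcal B^{\mathbb Z}$ if there exist a finite alphabet $\mathcal A$, a subshift $Y\subseteq\mathcal A^{\mathbb Z}$ and a morphism $\tau:\mathcal A^*\to\mathcal B^*$ with $\tau(\mathcal A)=\mathcal W$ such that $X$ is the smallest subshift containing $\tau(Y)$ (i.e. $X=\bigcup_{k\in\mathbb Z}S^k\tau(Y)$) and $\tau$ is recognizable in $Y$. Topological rank. Let $(X,T)$ be a minimal Cantor system (minimal homeomorphism of a Cantor set). A clopen Kakutani-Rohlin (CKR) partition of $X$ is a partition $\mathcal T=\{T^{-j}B(k):1\le k\le d,\ 0\le j<h(k)\}$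 of $X$, where $B(1),\dots,B(d)$ are clopen, $h(k)\geq 1$ and $\bigcup_k T^{-h(k)}B(k)=\bigcup_k B(k)$; its base is $B(\mathcal T)=\bigcup_k B(k)$, and it has $d$ towers $\mathcal T(k)=\{T^{-j}B(k):0\le j<h(k)\}$. A sequence $(\mathcal T_n)_{n\ge0}$ of CKR partitions, $\mathcal T_n=\{T^{-j}B_n(k):1\le k\le d_n,0\le j<h_n(k)\}$, $\mathcal T_0=\{X\}$, is nested if for all $n$: $B(\mathcal T_{n+1})\subseteq B(\mathcal T_n)$; $\mathcal T_{n+1}$ refines $\mathcal T_n$; $\bigcap_n B(\mathcal T_n)$ is a single point; and the partitions $\mathcal T_n$ span the topology of $X$. It is primitive if for every $n\ge1$ there is $N>n$ such that every tower of $\mathcal T_N$ crosses every tower of $\mathcal T_n$ (i.e. the points of each $T^{-(h_N(k)-1)}B_N(k)$, iterated by $T$ until reaching $B_N(k)$, completely cross all towers of $\mathcal T_n$). The system has finite topological rank if it admits a primitive nested sequence of CKR partitions with $d_n\le d$ for all $n$, for some $d$ (equivalently, a Bratteli-Vershik representation with at most $d$ vertices per level); the minimum such $d$ is its topological rank. *)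

theory Defs
  imports "HOL-Analysis.Analysis" "HOL-Library.Extended_Nat"
begin

section \<open>Subshifts\<close>

definition full_shift :: "'a set \<Rightarrow> (int \<Rightarrow> 'a) topology" where
  "full_shift A = product_topology (\<lambda>_. discrete_topology A) UNIV"

definition shift :: "(int \<Rightarrow> 'a) \<Rightarrow> (int \<Rightarrow> 'a)" where
  "shift x = (\<lambda>i. x (i + 1))"

definition subshift :: "'a set \<Rightarrow> (int \<Rightarrow> 'a) set \<Rightarrow> bool" where
  "subshift A X \<longleftrightarrow> finite A \<and> closedin (full_shift A) X \<and> shift ` X = X"

definition minimal_subshift :: "'a set \<Rightarrow> (int \<Rightarrow> 'a) set \<Rightarrow> bool" where
  "minimal_subshift A X \<longleftrightarrow>
     subshift A X \<and> X \<noteq> {} \<and> (\<forall>Z. subshift A Z \<and> Z \<subseteq> X \<longrightarrow> Z = {} \<or> Z = X)"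

definition factor :: "(int \<Rightarrow> 'a) \<Rightarrow> int \<Rightarrow> nat \<Rightarrow> 'a list" where
  "factor x i k = map (\<lambda>j. x (i + int j)) [0..<k]"

definition words :: "nat \<Rightarrow> (int \<Rightarrow> 'a) set \<Rightarrow> 'a list set" where
  "words k X = {factor x i k | x i. x \<in> X}"


section \<open>Morphisms and recognizability\<close>

text \<open>A morphism is given by the images of the letters. The word \<open>\<tau> (y n)\<close> occupies the
  coordinates from \<open>cut \<tau> y n\<close> up to, but excluding, \<open>cut \<tau> y (n + 1)\<close> in the concatenation;
  one of the two sums below is always empty.\<close>

definition cut :: "('a \<Rightarrow> 'b list) \<Rightarrow> (int \<Rightarrow> 'a) \<Rightarrow> int \<Rightarrow> int" where
  "cut \<tau> y n = (\<Sum>m\<in>{0..<n}. int (length (\<tau> (y m)))) - (\<Sum>m\<in>{n..<0}. int (length (\<tau> (y m))))"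

definition morphism_ext :: "('a \<Rightarrow> 'b list) \<Rightarrow> (int \<Rightarrow> 'a) \<Rightarrow> (int \<Rightarrow> 'b)" where
  "morphism_ext \<tau> y i =
     (let n = (THE n. cut \<tau> y n \<le> i \<and> i < cut \<tau> y (n + 1))
      in \<tau> (y n) ! nat (i - cut \<tau> y n))"

definition recognizable_morphism ::
    "'b set \<Rightarrow> ('a \<Rightarrow> 'b list) \<Rightarrow> (int \<Rightarrow> 'a) set \<Rightarrow> bool" where
  "recognizable_morphism B \<tau> Y \<longleftrightarrow>
     (\<forall>x \<in> topspace (full_shift B). \<forall>k k'. \<forall>y \<in> Y. \<forall>y' \<in> Y.
        k < length (\<tau> (y 0)) \<and> x = (shift ^^ k) (morphism_ext \<tau> y) \<and>
        k' < length (\<tau> (y' 0)) \<and> x = (shift ^^ k') (morphism_ext \<tau> y')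
        \<longrightarrow> k = k' \<and> y = y')"

definition smallest_subshift :: "'b set \<Rightarrow> (int \<Rightarrow> 'b) set \<Rightarrow> (int \<Rightarrow> 'b) set \<Rightarrow> bool" where
  "smallest_subshift B Z X \<longleftrightarrow>
     subshift B X \<and> Z \<subseteq> X \<and> (\<forall>X'. subshift B X' \<and> Z \<subseteq> X' \<longrightarrow> X \<subseteq> X')"

text \<open>The auxiliary alphabet is finite, so up to renaming of letters it is a finite set of
  natural numbers.\<close>

definition recognizable_words :: "'b set \<Rightarrow> (int \<Rightarrow> 'b) set \<Rightarrow> 'b list set \<Rightarrow> bool" where
  "recognizable_words B X W \<longleftrightarrow>
     finite W \<and> W \<subseteq> lists B \<and> [] \<notin> W \<and>
     (\<exists>(A :: nat set) Y \<tau>. subshift A Y \<and> \<tau> ` A = W \<and>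
        smallest_subshift B (morphism_ext \<tau> ` Y) X \<and> recognizable_morphism B \<tau> Y)"

definition K_inf :: "'b set \<Rightarrow> (int \<Rightarrow> 'b) set \<Rightarrow> nat \<Rightarrow> enat" where
  "K_inf B X n =
     (INF W \<in> {W. W \<subseteq> (\<Union>k\<in>{n..}. words k X) \<and> finite W \<and> recognizable_words B X W}. enat (card W))"

definition K :: "'b set \<Rightarrow> (int \<Rightarrow> 'b) set \<Rightarrow> enat" where
  "K B X = lim (K_inf B X)"


section \<open>Clopen Kakutani-Rohlin partitions and topological rank\<close>

text \<open>A system is a topology \<open>X\<close> with a self-map \<open>T\<close>; \<open>preim X T j B\<close> is the set \<open>T\<close> to the
  power \<open>-j\<close> of \<open>B\<close>. A partition is given by the number \<open>d\<close> of towers, their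
  bases \<open>B k\<close> and heights \<open>h k\<close> for \<open>k \<in> {1..d}\<close>.\<close>

definition preim :: "'a topology \<Rightarrow> ('a \<Rightarrow> 'a) \<Rightarrow> nat \<Rightarrow> 'a set \<Rightarrow> 'a set" where
  "preim X T j B = {x \<in> topspace X. (T ^^ j) x \<in> B}"

definition levels :: "nat \<Rightarrow> (nat \<Rightarrow> nat) \<Rightarrow> (nat \<times> nat) set" where
  "levels d h = {(k, j). k \<in> {1..d} \<and> j < h k}"

definition atoms ::
    "'a topology \<Rightarrow> ('a \<Rightarrow> 'a) \<Rightarrow> nat \<Rightarrow> (nat \<Rightarrow> 'a set) \<Rightarrow> (nat \<Rightarrow> nat) \<Rightarrow> 'a set set" where
  "atoms X T d B h = (\<lambda>(k, j). preim X T j (B k)) ` levels d h"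

definition base :: "nat \<Rightarrow> (nat \<Rightarrow> 'a set) \<Rightarrow> 'a set" where
  "base d B = (\<Union>k\<in>{1..d}. B k)"

definition CKR_partition ::
    "'a topology \<Rightarrow> ('a \<Rightarrow> 'a) \<Rightarrow> nat \<Rightarrow> (nat \<Rightarrow> 'a set) \<Rightarrow> (nat \<Rightarrow> nat) \<Rightarrow> bool" where
  "CKR_partition X T d B h \<longleftrightarrow>
     (\<forall>k\<in>{1..d}. openin X (B k) \<and> closedin X (B k) \<and> h k \<ge> 1) \<and>
     disjoint_family_on (\<lambda>(k, j). preim X T j (B k)) (levels d h) \<and>
     partition_on (topspace X) (atoms X T d B h) \<and>
     (\<Union>k\<in>{1..d}. preim X T (h k) (B k)) = base d B"

definition nested_CKR ::
    "'a topology \<Rightarrow> ('a \<Rightarrow> 'a) \<Rightarrow>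
     (nat \<Rightarrow> nat) \<Rightarrow> (nat \<Rightarrow> nat \<Rightarrow> 'a set) \<Rightarrow> (nat \<Rightarrow> nat \<Rightarrow> nat) \<Rightarrow> bool" where
  "nested_CKR X T d B h \<longleftrightarrow>
     (\<forall>n. CKR_partition X T (d n) (B n) (h n)) \<and>
     atoms X T (d 0) (B 0) (h 0) = {topspace X} \<and>
     (\<forall>n. base (d (Suc n)) (B (Suc n)) \<subseteq> base (d n) (B n)) \<and>
     (\<forall>n. \<forall>P \<in> atoms X T (d (Suc n)) (B (Suc n)) (h (Suc n)).
            \<exists>Q \<in> atoms X T (d n) (B n) (h n). P \<subseteq> Q) \<and>
     (\<exists>x. (\<Inter>n. base (d n) (B n)) = {x}) \<and>
     topology_generated_by (\<Union>n. atoms X T (d n) (B n) (h n)) = X"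

text \<open>The points of \<open>preim X T (H - 1) C\<close> need \<open>H - 1\<close> iterations of \<open>T\<close> to run
  through the tower with base \<open>C\<close> and height \<open>H\<close>. On the way they must enter the tower with base
  \<open>B\<close> and height \<open>h\<close> through its farthest level and run through all of it before time \<open>H\<close>.\<close>

definition tower_crosses ::
    "'a topology \<Rightarrow> ('a \<Rightarrow> 'a) \<Rightarrow> 'a set \<Rightarrow> nat \<Rightarrow> 'a set \<Rightarrow> nat \<Rightarrow> bool" where
  "tower_crosses X T C H B h \<longleftrightarrow>
     (\<forall>x \<in> preim X T (H - 1) C. \<exists>i. i + h \<le> H \<and>
        (\<forall>j<h. (T ^^ (i + j)) x \<in> preim X T (h - 1 - j) B))"

definition primitive_CKR ::
    "'a topology \<Rightarrow> ('a \<Rightarrow> 'a) \<Rightarrow>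
     (nat \<Rightarrow> nat) \<Rightarrow> (nat \<Rightarrow> nat \<Rightarrow> 'a set) \<Rightarrow> (nat \<Rightarrow> nat \<Rightarrow> nat) \<Rightarrow> bool" where
  "primitive_CKR X T d B h \<longleftrightarrow>
     (\<forall>n\<ge>1. \<exists>N>n. \<forall>k\<in>{1..d N}. \<forall>l\<in>{1..d n}. tower_crosses X T (B N k) (h N k) (B n l) (h n l))"

definition topological_rank_le :: "'a topology \<Rightarrow> ('a \<Rightarrow> 'a) \<Rightarrow> nat \<Rightarrow> bool" where
  "topological_rank_le X T r \<longleftrightarrow>
     (\<exists>d B h. nested_CKR X T d B h \<and> primitive_CKR X T d B h \<and> (\<forall>n. d n \<le> r))"

definition finite_topological_rank :: "'a topology \<Rightarrow> ('a \<Rightarrow> 'a) \<Rightarrow> bool" where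
  "finite_topological_rank X T \<longleftrightarrow> (\<exists>r. topological_rank_le X T r)"


section \<open>Well-definedness\<close>

lemma K_inf_LIMSEQ: "K_inf B X \<longlonglongrightarrow> K B X"
proof -
  have "(\<Union>k\<in>{n..}. words k X) \<subseteq> (\<Union>k\<in>{m..}. words k X)" if "m \<le> n" for m n
    using that by (intro UN_mono) auto
  hence "K_inf B X m \<le> K_inf B X n" if "m \<le> n" for m n
    unfolding K_inf_def using that by (intro INF_superset_mono) blast+
  hence "incseq (K_inf B X)"
    by (simp add: incseq_def)
  hence "K_inf B X \<longlonglongrightarrow> (SUP n. K_inf B X n)"
    by (rule LIMSEQ_SUP)
  thus ?thesis
    unfolding K_def by (simp add: limI)
qed

lemma cut_0: "cut \<tau> y 0 = 0"
  by (simp add: cut_def)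

lemma cut_step: "cut \<tau> y (n + 1) = cut \<tau> y n + int (length (\<tau> (y n)))"
proof (cases "0 \<le> n")
  case True
  have "{0..<n + 1} = insert n {0..<n}" using True by auto
  then show ?thesis using True by (simp add: cut_def)
next
  case False
  have "{n..<0} = insert n {n + 1..<0}" using False by auto
  then show ?thesis using False by (simp add: cut_def)
qed

lemma cut_strict_mono:
  assumes "\<And>n. \<tau> (y n) \<noteq> []"
  shows "strict_mono (cut \<tau> y)"
proof (rule strict_monoI)
  fix m n :: int
  assume "m < n"
  then show "cut \<tau> y m < cut \<tau> y n"
  proof (induction n rule: int_gr_induct)
    case base then show ?case using assms by (simp add: cut_step)
  next
    case (step i) 
    have "length (\<tau> (y i)) > 0" using assms by simp
    then show ?case using step by (simp add: cut_step)
  qed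
qed

text \<open>Concatenation: reading the extension from \<open>cut \<tau> y n\<close> on gives \<open>\<tau> (y n)\<close>.\<close>

lemma factor_morphism_ext:
  assumes "\<And>n. \<tau> (y n) \<noteq> []"
  shows "factor (morphism_ext \<tau> y) (cut \<tau> y n) (length (\<tau> (y n))) = \<tau> (y n)"
proof (rule nth_equalityI)
  fix j assume "j < length (factor (morphism_ext \<tau> y) (cut \<tau> y n) (length (\<tau> (y n))))"
  hence j: "j < length (\<tau> (y n))" by (simp add: factor_def)
  let ?i = "cut \<tau> y n + int j"
  note sm = cut_strict_mono[of \<tau> y, OF assms]
  have "(THE m. cut \<tau> y m \<le> ?i \<and> ?i < cut \<tau> y (m + 1)) = n"
  proof (rule the_equality)
    show "cut \<tau> y n \<le> ?i \<and> ?i < cut \<tau> y (n + 1)" using j by (simp add: cut_step)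
  next
    fix m assume m: "cut \<tau> y m \<le> ?i \<and> ?i < cut \<tau> y (m + 1)"
    have "cut \<tau> y m < cut \<tau> y (n + 1)" "cut \<tau> y n < cut \<tau> y (m + 1)"
      using m j by (auto simp: cut_step[of \<tau> y n])
    hence "m < n + 1" "n < m + 1" by (simp_all add: strict_mono_less[OF sm])
    thus "m = n" by simp
  qed
  thus "factor (morphism_ext \<tau> y) (cut \<tau> y n) (length (\<tau> (y n))) ! j = \<tau> (y n) ! j"
    using j by (simp add: factor_def morphism_ext_def)
qed (simp add: factor_def)

end

theory Submission imports Defs begin

text \<open>If the towers of a partition have height at least \<open>n\<close> and its levels determine the coordinate
  \<open>0\<close>, then the words read along its towers are recognizable: a point determines the tower levels it
  visits. In a nested sequence the heights tend to infinity since the bases shrink to a single,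
  non-periodic point, so \<open>K\<close> is at most the bound on the numbers of towers.

  Conversely, a recognizable set of \<open>r\<close> words of length at least \<open>n\<close> gives a clopen set all of
  whose return words are among these words. For different \<open>n\<close> these clopen sets are unrelated, but
  delaying each visit to the first subsequent visit to a prescribed clopen set \<open>U\<close> moves the base into \<open>U\<close>,
  and labelling the towers by three consecutive words makes their levels as fine as required once
  \<open>n\<close> is large. The number of towers, at most \<open>r ^ 3\<close>, does not grow along the construction.\<close>

section \<open>Windows\<close>

text \<open>The order of choices is what keeps the number of towers bounded. Refining a given
  partition dictates a radius \<open>m\<close> (its atoms are clopen, hence seen through a finite
  window), and the set \<open>U\<close> dictates a bound \<open>G\<close> on the delays. Labelling
  by all words of radius \<open>m\<close> would let the number of towers grow with \<open>m\<close>.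
  Instead the length bound \<open>N\<close> is chosen last, larger than \<open>G + m\<close>, so
  that a delay together with a margin of \<open>m\<close> coordinates fits into one return word. The
  tower between two delayed visits is then covered by the return word between the two original
  visits and its two neighbours: the left one supplies the left margin, the right one the second
  delay and the right margin. This is the origin of the exponent 3, and the reason why finiteness is
  compared and not the values. Primitivity costs nothing: by minimality every tower is met within
  bounded time, so tall towers cross all towers of an earlier level. Towers are indexed backwards in
  time (level \<open>j\<close> is \<open>T^-j\<close> of the base). The base is thus the level
  visited last, and return times and return words are read into the past throughout.\<close>

definition sh :: "int \<Rightarrow> (int \<Rightarrow> 'a) \<Rightarrow> (int \<Rightarrow> 'a)" where
  "sh n x = (\<lambda>i. x (i + n))"

lemma sh_apply: "sh n x i = x (i + n)"
  by (simp add: sh_def)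

lemma sh_sh [simp]: "sh m (sh n x) = sh (m + n) x"
  by (simp add: sh_def add.assoc)

lemma sh_0 [simp]: "sh 0 x = x"
  by (simp add: sh_def)

lemma sh_eq_iff [simp]: "sh n x = sh n y \<longleftrightarrow> x = y"
  by (metis add.left_inverse sh_0 sh_sh)

lemma shift_eq_sh: "shift = sh 1"
  by (simp add: shift_def sh_def fun_eq_iff)

lemma shift_funpow: "(shift ^^ k) x = sh (int k) x"
  by (induction k) (simp_all add: shift_eq_sh add.commute)

text \<open>Closeness in the product topology: the balls of the usual metric on sequences, indexed
  by the radius of the central block.\<close>

definition agree :: "nat \<Rightarrow> (int \<Rightarrow> 'a) \<Rightarrow> (int \<Rightarrow> 'a) \<Rightarrow> bool" where
  "agree m x y \<longleftrightarrow> (\<forall>i. \<bar>i\<bar> \<le> int m \<longrightarrow> x i = y i)"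

lemma agree_refl [simp]: "agree m x x"
  by (simp add: agree_def)

lemma agree_sym: "agree m x y \<Longrightarrow> agree m y x"
  by (simp add: agree_def)

lemma agree_trans: "agree m x y \<Longrightarrow> agree m y z \<Longrightarrow> agree m x z"
  by (simp add: agree_def)

lemma agree_mono: "agree n x y \<Longrightarrow> m \<le> n \<Longrightarrow> agree m x y"
  by (simp add: agree_def)

lemma agree_sh: "agree (m + nat \<bar>k\<bar>) x y \<Longrightarrow> agree m (sh k x) (sh k y)"
  unfolding agree_def sh_apply by simp

lemma agree_all_imp_eq: "(\<And>m. agree m x y) \<Longrightarrow> x = y"
  by (rule ext) (metis agree_def abs_ge_zero int_nat_eq order_refl)

lemma topspace_full_shift: "x \<in> topspace (full_shift A) \<longleftrightarrow> (\<forall>i. x i \<in> A)"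
  by (auto simp: full_shift_def PiE_UNIV_domain)

lemma cylinder_open:
  assumes "x \<in> topspace (full_shift A)"
  shows "openin (full_shift A) {y \<in> topspace (full_shift A). agree m x y}"
proof -
  have "{y \<in> topspace (full_shift A). agree m x y} =
      Pi\<^sub>E UNIV (\<lambda>i. if \<bar>i\<bar> \<le> int m then {x i} else A)" (is "_ = ?R")
  proof (rule set_eqI)
    fix y
    have eq: "y \<in> ?R \<longleftrightarrow> (\<forall>i. (\<bar>i\<bar> \<le> int m \<longrightarrow> y i = x i) \<and> (\<not> \<bar>i\<bar> \<le> int m \<longrightarrow> y i \<in> A))"
      unfolding PiE_UNIV_domain Pi_iff by (auto split: if_splits)
    have xA: "x i \<in> A" for i using assms by (simp add: topspace_full_shift)
    show "y \<in> {y \<in> topspace (full_shift A). agree m x y} \<longleftrightarrow> y \<in> ?R"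
      unfolding eq topspace_full_shift mem_Collect_eq agree_def
      using xA by (safe; metis)
  qed
  moreover have "openin (full_shift A) ?R"
  proof -
    have "finite {i::int. \<bar>i\<bar> \<le> int m}"
      by (rule finite_subset[of _ "{- int m..int m}"]) auto
    then have "finite {i. (if \<bar>i\<bar> \<le> int m then {x i} else A) \<noteq> A}"
      by (rule rev_finite_subset) auto
    then show ?thesis
      using assms unfolding full_shift_def
      by (intro product_topology_basis) (auto simp: PiE_UNIV_domain)
  qed
  ultimately show ?thesis by simp
qed

text \<open>A basic open set of the product restricts finitely many coordinates, and a symmetric
  window containing them all gives \<open>m\<close>. From here on open and closed sets are handled
  through finite windows.\<close>

lemma openin_window_iff:
  assumes "X \<subseteq> topspace (full_shift A)"
  shows "openin (subtopology (full_shift A) X) V \<longleftrightarrow>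
    V \<subseteq> X \<and> (\<forall>x\<in>V. \<exists>m. \<forall>y\<in>X. agree m x y \<longrightarrow> y \<in> V)"
proof safe
  fix x assume V: "openin (subtopology (full_shift A) X) V"
  then show "x \<in> V \<Longrightarrow> x \<in> X"
    using openin_subset by fastforce
  assume "x \<in> V"
  from V obtain U where U: "openin (full_shift A) U" "V = U \<inter> X"
    by (auto simp: openin_subtopology)
  then obtain E where E: "x \<in> Pi\<^sub>E UNIV E" "finite {i. E i \<noteq> A}" "Pi\<^sub>E UNIV E \<subseteq> U"
    using \<open>x \<in> V\<close> product_topology_open_contains_basis[of "\<lambda>_. discrete_topology A" UNIV U x]
    unfolding full_shift_def by auto
  define m where "m = nat (Max (insert 0 (abs ` {i. E i \<noteq> A})))"
  have "\<bar>i\<bar> \<le> int m" if "E i \<noteq> A" for i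
  proof -
    have "\<bar>i\<bar> \<le> Max (insert 0 (abs ` {i. E i \<noteq> A}))"
      using E that by (intro Max_ge) auto
    then show ?thesis unfolding m_def by linarith
  qed
  then have "y \<in> V" if y: "y \<in> X" "agree m x y" for y
  proof -
    have "y i \<in> E i" for i
      using E(1) y assms \<open>\<And>i. E i \<noteq> A \<Longrightarrow> \<bar>i\<bar> \<le> int m\<close>
      unfolding agree_def PiE_UNIV_domain
      by (metis (full_types) Pi_UNIV Pi_iff UNIV_I subsetD topspace_full_shift)
    then show ?thesis using E U y by (auto simp: PiE_UNIV_domain)
  qed
  then show "\<exists>m. \<forall>y\<in>X. agree m x y \<longrightarrow> y \<in> V" by blast
next
  assume V: "V \<subseteq> X" "\<forall>x\<in>V. \<exists>m. \<forall>y\<in>X. agree m x y \<longrightarrow> y \<in> V"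
  show "openin (subtopology (full_shift A) X) V"
  proof (subst openin_subopen, rule ballI)
    fix x assume x: "x \<in> V"
    then obtain m where m: "\<forall>y\<in>X. agree m x y \<longrightarrow> y \<in> V" using V by blast
    have "openin (subtopology (full_shift A) X) ({y \<in> topspace (full_shift A). agree m x y} \<inter> X)"
      using x V assms by (intro openin_subtopology_Int cylinder_open) auto
    then show "\<exists>T. openin (subtopology (full_shift A) X) T \<and> x \<in> T \<and> T \<subseteq> V"
      using m x V assms
      by (intro exI[of _ "{y \<in> topspace (full_shift A). agree m x y} \<inter> X"] conjI) auto
  qed
qed

lemma closedin_window_iff:
  assumes "X \<subseteq> topspace (full_shift A)"
  shows "closedin (subtopology (full_shift A) X) F \<longleftrightarrow>
    F \<subseteq> X \<and> (\<forall>x\<in>X. (\<forall>m. \<exists>y\<in>F. agree m x y) \<longrightarrow> x \<in> F)"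
  unfolding closedin_def openin_window_iff[OF assms] topspace_subtopology_subset[OF assms] by blast

lemma subshift_closed:
  "subshift A X \<longleftrightarrow> finite A \<and> (\<forall>x\<in>X. \<forall>i. x i \<in> A) \<and>
     (\<forall>x. (\<forall>m. \<exists>y\<in>X. agree m x y) \<longrightarrow> x \<in> X) \<and> shift ` X = X"
proof -
  have "closedin (full_shift A) X \<longleftrightarrow> closedin (subtopology (full_shift A) (topspace (full_shift A))) X"
    by simp
  also have "\<dots> \<longleftrightarrow> X \<subseteq> topspace (full_shift A) \<and>
     (\<forall>x\<in>topspace (full_shift A). (\<forall>m. \<exists>y\<in>X. agree m x y) \<longrightarrow> x \<in> X)"
    by (rule closedin_window_iff) simp
  also have "\<dots> \<longleftrightarrow> (\<forall>x\<in>X. \<forall>i. x i \<in> A) \<and> (\<forall>x. (\<forall>m. \<exists>y\<in>X. agree m x y) \<longrightarrow> x \<in> X)"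
  proof -
    have "x \<in> topspace (full_shift A)"
      if ap: "\<forall>m. \<exists>y\<in>X. agree m x y" and sub: "X \<subseteq> topspace (full_shift A)" for x
      unfolding topspace_full_shift
    proof
      fix i
      obtain y where "y \<in> X" "agree (nat \<bar>i\<bar>) x y" using ap by blast
      then have "x i = y i" "y \<in> topspace (full_shift A)" using sub by (auto simp: agree_def)
      then show "x i \<in> A" by (simp add: topspace_full_shift)
    qed
    moreover have "X \<subseteq> topspace (full_shift A) \<longleftrightarrow> (\<forall>x\<in>X. \<forall>i. x i \<in> A)"
      unfolding subset_iff topspace_full_shift by (rule Ball_def[symmetric])
    ultimately show ?thesis by metis
  qed
  finally show ?thesis unfolding subshift_def by blast
qed

text \<open>These are exactly the clopen subsets of \<open>X\<close>, see
  \<open>window_imp_clopen\<close> and \<open>clopen_imp_window\<close>. The radius is kept as a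
  parameter because the choice of word lengths depends on it.\<close>

definition window :: "(int \<Rightarrow> 'a) set \<Rightarrow> nat \<Rightarrow> (int \<Rightarrow> 'a) set \<Rightarrow> bool" where
  "window X m V \<longleftrightarrow> V \<subseteq> X \<and> (\<forall>x\<in>X. \<forall>y\<in>X. agree m x y \<longrightarrow> x \<in> V \<longrightarrow> y \<in> V)"

lemma windowD: "window X m V \<Longrightarrow> x \<in> X \<Longrightarrow> y \<in> X \<Longrightarrow> agree m x y \<Longrightarrow> x \<in> V \<longleftrightarrow> y \<in> V"
  unfolding window_def using agree_sym by blast

lemma window_mono: "window X m V \<Longrightarrow> m \<le> n \<Longrightarrow> window X n V"
  unfolding window_def using agree_mono by blast

section \<open>Compactness and clopen sets of a subshift\<close>

locale shift_space =
  fixes A :: "'a set" and X :: "(int \<Rightarrow> 'a) set"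
  assumes subshift: "subshift A X"
begin

abbreviation "XT \<equiv> subtopology (full_shift A) X"

lemma finite_A: "finite A" and X_A: "x \<in> X \<Longrightarrow> x i \<in> A"
  and X_closed: "(\<And>m. \<exists>y\<in>X. agree m x y) \<Longrightarrow> x \<in> X"
  and shift_X: "shift ` X = X"
  using subshift unfolding subshift_closed by blast+

lemma X_sub: "X \<subseteq> topspace (full_shift A)"
  using X_A by (auto simp: topspace_full_shift)

lemma topspace_XT [simp]: "topspace XT = X"
  using X_sub by (rule topspace_subtopology_subset)

lemma closedin_X: "closedin (full_shift A) X"
  using subshift by (simp add: subshift_def)

lemma sh_in_X [simp]: "sh n x \<in> X \<longleftrightarrow> x \<in> X"
proof -
  have fwd: "sh 1 x \<in> X" if "x \<in> X" for x using that shift_X by (auto simp: shift_eq_sh)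
  have bwd: "sh (-1) x \<in> X" if "x \<in> X" for x
  proof -
    have "x \<in> sh 1 ` X" using that shift_X by (simp add: shift_eq_sh)
    then obtain z where "z \<in> X" "x = sh 1 z" by blast
    then show ?thesis by simp
  qed
  have "sh n x \<in> X" if "x \<in> X" for n x
  proof (induction n rule: int_induct[where k = 0])
    case base show ?case using that by simp
  next
    case (step1 i) then show ?case using fwd[of "sh i x"] by (simp add: add.commute)
  next
    case (step2 i) then show ?case using bwd[of "sh i x"] by (simp add: add.commute)
  qed
  from this[of x n] this[of "sh n x" "- n"] show ?thesis by auto
qed

lemma compact_XT: "compact_space XT"
proof -
  have "compact_space (full_shift A)"
    unfolding full_shift_def
    using finite_A by (auto simp: compact_space_product_topology compact_space_discrete_topology)
  then show ?thesis using closedin_X by (simp add: closedin_compact_space compact_space_subtopology)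
qed

text \<open>Compactness in the form used below: an exceptional set that shrinks to nothing is empty
  at some finite stage.\<close>

lemma nest:
  assumes "\<And>n. closedin XT (F n)" "\<And>n. F (Suc n) \<subseteq> F n" "(\<Inter>n. F n) = {}"
  shows "\<exists>n. F n = {}"
proof (rule ccontr)
  assume "\<not> ?thesis"
  moreover have "decseq F" using assms(2) by (simp add: decseq_SucI)
  ultimately have "(\<Inter>n. F n) \<noteq> {}"
    using assms(1) by (intro compact_space_imp_nest[OF compact_XT]) auto
  then show False using assms(3) by blast
qed

lemma window_imp_clopen:
  assumes "window X m V"
  shows "openin XT V" "closedin XT V"
proof -
  have V: "V \<subseteq> X" using assms by (simp add: window_def)
  show "openin XT V"
    unfolding openin_window_iff[OF X_sub]
  proof (intro conjI ballI exI impI)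
    fix x y assume "x \<in> V" "y \<in> X" "agree m x y"
    then show "y \<in> V" using windowD[OF assms, of x y] V by blast
  qed (rule V)
  show "closedin XT V"
    unfolding closedin_window_iff[OF X_sub]
  proof (intro conjI ballI impI)
    fix x assume "x \<in> X" "\<forall>m. \<exists>y\<in>V. agree m x y"
    then obtain y where "x \<in> X" "y \<in> V" "agree m x y" by blast
    then show "x \<in> V" using windowD[OF assms, of x y] V by blast
  qed (rule V)
qed

text \<open>Compactness makes the radius uniform. \<open>F m\<close> collects the points whose block
  of radius \<open>m\<close> does not decide membership in \<open>V\<close>. These sets are closed
  and decreasing, and every point eventually leaves them because \<open>V\<close> and its complement
  are both open.\<close>

lemma clopen_imp_window:
  assumes "openin XT V" "closedin XT V"
  shows "\<exists>m. window X m V"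
proof -
  define F where "F m = {x \<in> X. \<exists>y\<in>X. agree m x y \<and> (x \<in> V \<longleftrightarrow> y \<notin> V)}" for m
  have V: "V \<subseteq> X" using openin_subset[OF assms(1)] by simp
  have "window X m (F m)" for m
    unfolding window_def
  proof (intro conjI ballI impI)
    show "F m \<subseteq> X" by (auto simp: F_def)
    fix x z assume xz: "x \<in> X" "z \<in> X" "agree m x z" "x \<in> F m"
    then obtain y where y: "y \<in> X" "agree m x y" "x \<in> V \<longleftrightarrow> y \<notin> V" by (auto simp: F_def)
    have "agree m z x" "agree m z y" using xz y agree_sym agree_trans by metis+
    then show "z \<in> F m" using xz y by (auto simp: F_def)
  qed
  then have "closedin XT (F m)" for m using window_imp_clopen by blast
  moreover have "F (Suc m) \<subseteq> F m" for m
    unfolding F_def by (auto dest: agree_mono[of "Suc m" _ _ m])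
  moreover have "(\<Inter>m. F m) = {}"
  proof -
    have "\<exists>m. x \<notin> F m" if x: "x \<in> X" for x
    proof (cases "x \<in> V")
      case True
      then obtain m where "\<forall>y\<in>X. agree m x y \<longrightarrow> y \<in> V"
        using assms(1) unfolding openin_window_iff[OF X_sub] by blast
      then show ?thesis using True by (auto simp: F_def)
    next
      case False
      then have "x \<in> X - V" "openin XT (X - V)"
        using x assms(2) by (simp_all add: closedin_def del: topspace_subtopology)
      then obtain m where "\<forall>y\<in>X. agree m x y \<longrightarrow> y \<in> X - V"
        unfolding openin_window_iff[OF X_sub] by blast
      then show ?thesis using False by (auto simp: F_def)
    qed
    moreover have "F m \<subseteq> X" for m by (auto simp: F_def)
    ultimately show ?thesis by blast
  qed
  ultimately obtain m where m: "F m = {}" using nest[of F] by blast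
  have "window X m V"
    unfolding window_def
  proof (intro conjI ballI impI)
    fix x y assume "x \<in> X" "y \<in> X" "agree m x y" "x \<in> V"
    moreover have "x \<notin> F m" using m by simp
    ultimately show "y \<in> V" unfolding F_def by blast
  qed (rule V)
  then show ?thesis by blast
qed

end

section \<open>Minimality: bounded visiting times and aperiodicity\<close>

locale infinite_minimal =
  fixes A :: "'a set" and X :: "(int \<Rightarrow> 'a) set"
  assumes minimal: "minimal_subshift A X" and infinite_X: "infinite X"

sublocale infinite_minimal \<subseteq> shift_space A X
  using minimal by unfold_locales (simp add: minimal_subshift_def)

context infinite_minimal
begin

lemma minimalD:
  assumes "closedin XT Z" "Z \<noteq> {}" "\<And>x. x \<in> Z \<Longrightarrow> sh 1 x \<in> Z" "\<And>x. x \<in> Z \<Longrightarrow> sh (-1) x \<in> Z"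
  shows "Z = X"
proof -
  have Z: "closedin (full_shift A) Z" "Z \<subseteq> X"
    using assms(1) closedin_X closedin_trans_full closedin_subset by fastforce+
  have "x \<in> shift ` Z" if "x \<in> Z" for x
    using assms(4)[OF that] by (auto simp: shift_eq_sh intro!: image_eqI[of _ _ "sh (-1) x"])
  then have "shift ` Z = Z" using assms(3) by (auto simp: shift_eq_sh)
  then have "subshift A Z" using Z finite_A by (simp add: subshift_def)
  then show ?thesis using Z assms(2) minimal unfolding minimal_subshift_def by blast
qed

text \<open>The points that avoid \<open>U\<close> for all integer times form a closed invariant
  set, which is empty by minimality. Compactness then bounds the time needed. Two-sided times are
  used at first because they make the limiting set invariant in both directions.\<close>

lemma visits:
  assumes "openin XT U" "U \<noteq> {}"
  shows "\<exists>G. \<forall>x\<in>X. \<exists>j\<le>G. sh (int j) x \<in> U"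
proof -
  define F where "F n = {x \<in> X. \<forall>j. \<bar>j\<bar> \<le> int n \<longrightarrow> sh j x \<notin> U}" for n
  have clU: "closedin XT (X - U)"
    using assms(1) by (metis closedin_diff closedin_topspace topspace_XT)
  have cl: "closedin XT (F n)" for n
    unfolding closedin_window_iff[OF X_sub]
  proof (intro conjI ballI impI)
    show "F n \<subseteq> X" by (auto simp: F_def)
  next
    fix x assume x: "x \<in> X" and ap: "\<forall>m. \<exists>y\<in>F n. agree m x y"
    have "sh j x \<in> X - U" if "\<bar>j\<bar> \<le> int n" for j
    proof -
      have "\<exists>y\<in>X - U. agree m (sh j x) y" for m
      proof -
        obtain y where "y \<in> F n" "agree (m + nat \<bar>j\<bar>) x y" using ap by blast
        then show ?thesis using that agree_sh unfolding F_def by fastforce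
      qed
      then show ?thesis using x clU unfolding closedin_window_iff[OF X_sub] by auto
    qed
    then show "x \<in> F n" using x by (auto simp: F_def)
  qed
  have I: "(\<Inter>n. F n) = {x \<in> X. \<forall>j. sh j x \<notin> U}" (is "_ = ?I")
    unfolding F_def by (auto, metis abs_ge_zero int_nat_eq order_refl)
  have "?I = {}"
  proof (rule ccontr)
    assume "?I \<noteq> {}"
    moreover have "closedin XT ?I" unfolding I[symmetric] using cl by blast
    ultimately have "?I = X" by (intro minimalD) auto
    moreover obtain u where "u \<in> U" using assms(2) by blast
    moreover have "u \<in> X" using openin_subset[OF assms(1)] \<open>u \<in> U\<close> by auto
    ultimately have "sh 0 u \<notin> U" by blast
    then show False using \<open>u \<in> U\<close> by simp
  qed
  then have "(\<Inter>n. F n) = {}" unfolding I .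
  moreover have "F (Suc n) \<subseteq> F n" for n unfolding F_def by auto
  ultimately obtain n where n: "F n = {}" using nest[of F] cl by blast
  \<comment> \<open>Starting from the point \<open>sh n x\<close>, the two-sided range of radius
    \<open>n\<close> becomes the forward range from 0 to \<open>2 * n\<close> of
    \<open>x\<close>.\<close>
  show "\<exists>G. \<forall>x\<in>X. \<exists>j\<le>G. sh (int j) x \<in> U"
  proof (rule exI[of _ "2 * n"], rule ballI)
    fix x assume "x \<in> X"
    then have "sh (int n) x \<notin> F n" "sh (int n) x \<in> X" using n by auto
    then obtain j where j: "\<bar>j\<bar> \<le> int n" "sh (j + int n) x \<in> U" by (auto simp: F_def)
    then show "\<exists>j\<le>2 * n. sh (int j) x \<in> U"
      by (intro exI[of _ "nat (j + int n)"]) auto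
  qed
qed

text \<open>The orbit of a periodic point would be finite, hence closed, and by minimality all of
  the infinite set \<open>X\<close>.\<close>

lemma aperiodic:
  assumes "x \<in> X" "t > 0"
  shows "sh (int t) x \<noteq> x"
proof
  assume p: "sh (int t) x = x"
  define Z where "Z = (\<lambda>j. sh j x) ` {0..<int t}"
  have per: "sh (j + int t * k) x = sh j x" for j k
  proof (induction k rule: int_induct[where k = 0])
    case (step1 i)
    have "sh (j + int t * (i + 1)) x = sh (j + int t * i) (sh (int t) x)" by (simp add: algebra_simps)
    then show ?case using step1 p by simp
  next
    case (step2 i)
    have "sh (j + int t * (i - 1)) x = sh (j + int t * (i - 1)) (sh (int t) x)" using p by simp
    then show ?case using step2 by (simp add: algebra_simps)
  qed simp
  have mem: "sh j x \<in> Z" for j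
  proof -
    have "sh j x = sh (j mod int t) x" using per[of "j mod int t" "j div int t"] by simp
    then show ?thesis unfolding Z_def using assms(2) by (intro image_eqI) auto
  qed
  have fin: "finite Z" and ZX: "Z \<subseteq> X" using assms(1) by (auto simp: Z_def)
  have "Hausdorff_space (full_shift A)"
    unfolding full_shift_def by (simp add: Hausdorff_space_product_topology)
  then have "closedin XT Z"
    using fin ZX by (intro closedin_Hausdorff_finite) (use X_sub in \<open>auto simp: Hausdorff_space_subtopology\<close>)
  moreover have "Z \<noteq> {}" using mem by blast
  ultimately have "Z = X" by (rule minimalD) (auto simp: Z_def mem[unfolded Z_def])
  then show False using fin infinite_X by simp
qed

end

section \<open>Morphisms\<close>

context
  fixes \<tau> :: "'a \<Rightarrow> 'b list" and y :: "int \<Rightarrow> 'a"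
  assumes ne: "\<And>n. \<tau> (y n) \<noteq> []"
begin

lemma cut_bounds: "0 \<le> n \<Longrightarrow> n \<le> cut \<tau> y n" "n \<le> 0 \<Longrightarrow> cut \<tau> y n \<le> n"
proof -
  have len: "1 \<le> int (length (\<tau> (y n)))" for n
    using ne[of n] by (simp add: Suc_le_eq)
  show "n \<le> cut \<tau> y n" if "0 \<le> n"
    using that
  proof (induction n rule: int_ge_induct)
    case (step i) then show ?case using len[of i] by (simp add: cut_step)
  qed (simp add: cut_0)
  show "cut \<tau> y n \<le> n" if "n \<le> 0"
    using that
  proof (induction n rule: int_le_induct)
    case (step i) then show ?case using len[of "i - 1"] cut_step[of \<tau> y "i - 1"] by simp
  qed (simp add: cut_0)
qed

lemma morphism_ext_at:
  assumes "cut \<tau> y n \<le> i" "i < cut \<tau> y (n + 1)"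
  shows "morphism_ext \<tau> y i = \<tau> (y n) ! nat (i - cut \<tau> y n)"
proof -
  have l: "nat (i - cut \<tau> y n) < length (\<tau> (y n))" using assms by (simp add: cut_step)
  have "\<tau> (y n) ! nat (i - cut \<tau> y n) =
      factor (morphism_ext \<tau> y) (cut \<tau> y n) (length (\<tau> (y n))) ! nat (i - cut \<tau> y n)"
    by (simp add: factor_morphism_ext ne)
  also have "\<dots> = morphism_ext \<tau> y i" using l assms(1) by (simp add: factor_def)
  finally show ?thesis by simp
qed

text \<open>The bound on \<open>n\<close> holds because each word has length at least 1. It makes
  coordinate \<open>i\<close> of the image depend only on letters at distance at most that of
  \<open>i\<close> from 0, so that \<open>agree_morphism_ext\<close> loses no radius.\<close>

lemma cut_cover: "\<exists>n. \<bar>n\<bar> \<le> \<bar>i\<bar> \<and> cut \<tau> y n \<le> i \<and> i < cut \<tau> y (n + 1)"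
proof -
  have len: "1 \<le> int (length (\<tau> (y n)))" for n
    using ne[of n] by (simp add: Suc_le_eq)
  have "\<exists>n. cut \<tau> y n \<le> i \<and> i < cut \<tau> y (n + 1)"
  proof (induction i rule: int_induct[where k = 0])
    case base
    show ?case using len[of 0] cut_step[of \<tau> y 0] by (intro exI[of _ 0]) (simp add: cut_0 ne)
  next
    case (step1 i)
    then obtain n where n: "cut \<tau> y n \<le> i" "i < cut \<tau> y (n + 1)" by blast
    show ?case
    proof (cases "i + 1 < cut \<tau> y (n + 1)")
      case True then show ?thesis using n by (intro exI[of _ n]) simp
    next
      case False
      then show ?thesis using n len[of "n + 1"] cut_step[of \<tau> y "n + 1"]
        by (intro exI[of _ "n + 1"]) (simp add: ne)
    qed
  next
    case (step2 i)
    then obtain n where n: "cut \<tau> y n \<le> i" "i < cut \<tau> y (n + 1)" by blast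
    show ?case
    proof (cases "cut \<tau> y n \<le> i - 1")
      case True then show ?thesis using n by (intro exI[of _ n]) simp
    next
      case False
      then show ?thesis using n len[of "n - 1"] cut_step[of \<tau> y "n - 1"]
        by (intro exI[of _ "n - 1"]) (simp add: ne)
    qed
  qed
  then obtain n where n: "cut \<tau> y n \<le> i" "i < cut \<tau> y (n + 1)" by blast
  have "\<bar>n\<bar> \<le> \<bar>i\<bar>"
  proof (cases "0 \<le> n")
    case True then show ?thesis using n cut_bounds(1)[of n] by simp
  next
    case False then show ?thesis using n cut_bounds(2)[of "n + 1"] by simp
  qed
  then show ?thesis using n by blast
qed

lemma cut_sh: "cut \<tau> (sh n y) i = cut \<tau> y (i + n) - cut \<tau> y n"
proof (induction i rule: int_induct[where k = 0])
  case base show ?case by (simp add: cut_0)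
next
  case (step1 i)
  then show ?case using cut_step[of \<tau> "sh n y" i] cut_step[of \<tau> y "i + n"]
    by (simp add: sh_apply[of n y i] algebra_simps)
next
  case (step2 i)
  then show ?case using cut_step[of \<tau> "sh n y" "i - 1"] cut_step[of \<tau> y "i - 1 + n"]
    by (simp add: sh_apply[of n y "i - 1"] algebra_simps)
qed

end

lemma morphism_ext_sh:
  assumes "\<And>n. \<tau> (y n) \<noteq> []"
  shows "morphism_ext \<tau> (sh n y) = sh (cut \<tau> y n) (morphism_ext \<tau> y)"
proof
  fix i
  have ne: "\<tau> (sh n y m) \<noteq> []" for m unfolding sh_apply by (rule assms)
  obtain k where k: "cut \<tau> (sh n y) k \<le> i" "i < cut \<tau> (sh n y) (k + 1)"
    using cut_cover[of \<tau> "sh n y" i] ne by blast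
  then have "cut \<tau> y (k + n) \<le> i + cut \<tau> y n" "i + cut \<tau> y n < cut \<tau> y (k + n + 1)"
    using assms by (simp_all add: cut_sh algebra_simps)
  then have "morphism_ext \<tau> y (i + cut \<tau> y n) = \<tau> (y (k + n)) ! nat (i + cut \<tau> y n - cut \<tau> y (k + n))"
    using assms by (simp add: morphism_ext_at)
  moreover have "morphism_ext \<tau> (sh n y) i = \<tau> (sh n y k) ! nat (i - cut \<tau> (sh n y) k)"
    using k ne by (simp add: morphism_ext_at)
  ultimately show "morphism_ext \<tau> (sh n y) i = sh (cut \<tau> y n) (morphism_ext \<tau> y) i"
    using assms unfolding sh_apply[of _ _ i] sh_apply[of n y k] by (simp add: cut_sh algebra_simps)
qed

lemma cut_cong: "(\<And>m. \<bar>m\<bar> \<le> \<bar>n\<bar> \<Longrightarrow> y m = y' m) \<Longrightarrow> cut \<tau> y n = cut \<tau> y' n"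
  unfolding cut_def by (intro arg_cong2[of _ _ _ _ "(-)"] sum.cong) auto

lemma agree_morphism_ext:
  assumes "\<And>n. \<tau> (y n) \<noteq> []" "\<And>n. \<tau> (y' n) \<noteq> []" "agree m y y'"
  shows "agree m (morphism_ext \<tau> y) (morphism_ext \<tau> y')"
  unfolding agree_def
proof (intro allI impI)
  fix i :: int assume i: "\<bar>i\<bar> \<le> int m"
  obtain n where n: "\<bar>n\<bar> \<le> \<bar>i\<bar>" "cut \<tau> y n \<le> i" "i < cut \<tau> y (n + 1)"
    using cut_cover[of \<tau> y i] assms by blast
  have eq: "y k = y' k" if "\<bar>k\<bar> \<le> \<bar>n\<bar>" for k using that n i assms(3) by (simp add: agree_def)
  then have c: "cut \<tau> y n = cut \<tau> y' n" by (rule cut_cong)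
  then have "cut \<tau> y (n + 1) = cut \<tau> y' (n + 1)" using eq[of n] by (simp add: cut_step)
  then show "morphism_ext \<tau> y i = morphism_ext \<tau> y' i"
    using n c eq[of n] morphism_ext_at[of \<tau> y n i] morphism_ext_at[of \<tau> y' n i] assms by simp
qed

text \<open>The hypothesis \<open>mod\<close> is uniform continuity expressed by windows; the image
  of the compact set \<open>F\<close> is compact and therefore closed in the Hausdorff full
  shift.\<close>

lemma (in shift_space) closedin_image:
  assumes F: "closedin XT F" and im: "f ` F \<subseteq> topspace (full_shift B)"
    and mod: "\<And>m. \<exists>M. \<forall>x\<in>F. \<forall>y\<in>F. agree M x y \<longrightarrow> agree m (f x) (f y)"
  shows "closedin (full_shift B) (f ` F)"
proof -
  let ?T = "subtopology (full_shift A) F"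
  have FX: "F \<subseteq> X" using closedin_subset[OF F] by simp
  then have F': "F \<subseteq> topspace (full_shift A)" using X_sub by blast
  have "compactin XT F" using closedin_compact_space[OF compact_XT F] .
  then have "compact_space ?T"
    using FX by (simp add: compactin_subspace subtopology_subtopology inf_absorb2)
  moreover have "continuous_map ?T (full_shift B) f"
    unfolding continuous_map_def topspace_subtopology_subset[OF F']
  proof (intro conjI allI impI)
    show "f \<in> F \<rightarrow> topspace (full_shift B)" using im by blast
  next
    fix U assume U: "openin (full_shift B) U"
    show "openin ?T {x \<in> F. f x \<in> U}"
      unfolding openin_window_iff[OF F']
    proof (intro conjI ballI)
      fix x assume x: "x \<in> {x \<in> F. f x \<in> U}"
      obtain m where m: "\<forall>z\<in>topspace (full_shift B). agree m (f x) z \<longrightarrow> z \<in> U"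
        using U x openin_window_iff[of "topspace (full_shift B)" B U] by auto
      obtain M where "\<forall>x\<in>F. \<forall>y\<in>F. agree M x y \<longrightarrow> agree m (f x) (f y)" using mod by blast
      then have "\<forall>y\<in>F. agree M x y \<longrightarrow> y \<in> {x \<in> F. f x \<in> U}" using m x im by blast
      then show "\<exists>m. \<forall>y\<in>F. agree m x y \<longrightarrow> y \<in> {x \<in> F. f x \<in> U}" by blast
    qed blast
  qed
  ultimately have "compactin (full_shift B) (f ` topspace ?T)"
    unfolding compact_space_def by (rule image_compactin)
  moreover have "Hausdorff_space (full_shift B)"
    unfolding full_shift_def by (simp add: Hausdorff_space_product_topology)
  ultimately show ?thesis
    unfolding topspace_subtopology_subset[OF F'] by (blast intro: compactin_imp_closedin)
qed

lemma (in shift_space) window_preimage: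
  assumes "window X m V"
  shows "window X (m + nat \<bar>k\<bar>) {x \<in> X. sh k x \<in> V}"
  unfolding window_def
proof (intro conjI ballI impI)
  fix x y assume "x \<in> X" "y \<in> X" "agree (m + nat \<bar>k\<bar>) x y" "x \<in> {x \<in> X. sh k x \<in> V}"
  then show "y \<in> {x \<in> X. sh k x \<in> V}"
    using windowD[OF assms, of "sh k x" "sh k y"] agree_sh by auto
qed blast

section \<open>The clopen set of cutting points of a recognizable set of words\<close>

context infinite_minimal
begin

text \<open>The cutting points \<open>E y\<close> form a compact set, and so do the points at
  positive offset inside a word, a finite union of compact pieces. Together they exhaust
  \<open>X\<close>, and recognizability makes them disjoint; hence both are clopen. Consecutive
  cutting points are separated by exactly one word of \<open>W\<close>.\<close>

lemma recognizable_words_imp_returns: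
  assumes "recognizable_words A X W"
  obtains m D where "D \<noteq> {}" "window X m D"
    "\<And>x. x \<in> D \<Longrightarrow> \<exists>h\<ge>1. sh (- int h) x \<in> D \<and>
       (\<forall>t. 0 < t \<and> t < h \<longrightarrow> sh (- int t) x \<notin> D) \<and> factor x (1 - int h) h \<in> W"
proof -
  obtain L :: "nat set" and Y \<tau> where Y: "subshift L Y" and W: "\<tau> ` L = W" and W_ne: "[] \<notin> W"
    and sm: "smallest_subshift A (morphism_ext \<tau> ` Y) X"
    and rec: "recognizable_morphism A \<tau> Y"
    using assms unfolding recognizable_words_def by blast
  interpret Y: shift_space L Y by unfold_locales (rule Y)
  define E where "E = morphism_ext \<tau>"
  have ne: "\<tau> (y n) \<noteq> []" if "y \<in> Y" for y n using Y.X_A[OF that, of n] W W_ne by (metis imageI)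
  have EX: "E y \<in> X" if "y \<in> Y" for y
    using sm that unfolding smallest_subshift_def E_def by blast
  have Esh: "E (sh n y) = sh (cut \<tau> y n) (E y)" if "y \<in> Y" for y n
    unfolding E_def using ne[OF that] by (rule morphism_ext_sh)
  have uniq: "k = k'" if "y \<in> Y" "y' \<in> Y" "sh (int k) (E y) = sh (int k') (E y')"
      "k < length (\<tau> (y 0))" "k' < length (\<tau> (y' 0))" for y y' k k'
  proof -
    have "sh (int k) (E y) \<in> topspace (full_shift A)"
      using EX[OF that(1)] X_sub sh_in_X by blast
    then show ?thesis
      using rec that unfolding recognizable_morphism_def shift_funpow E_def by metis
  qed
  define R where "R k = {sh (int j) (E y) |j y. y \<in> Y \<and> k \<le> j \<and> j < length (\<tau> (y 0))}" for k
  have RI: "sh (int j) (E y) \<in> R k" if "y \<in> Y" "k \<le> j" "j < length (\<tau> (y 0))" for y j k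
    unfolding R_def using that by blast
  have R_eq: "R k = (\<Union>a\<in>L. \<Union>j\<in>{k..<length (\<tau> a)}. (\<lambda>y. sh (int j) (E y)) ` {y \<in> Y. y 0 = a})" for k
    unfolding R_def using Y.X_A by fastforce
  have R_X: "R k \<subseteq> X" for k unfolding R_def using EX by auto
  have piece: "closedin (full_shift A) ((\<lambda>y. sh (int j) (E y)) ` {y \<in> Y. y 0 = a})" for a j
  proof (rule Y.closedin_image)
    have "window Y 0 {y \<in> Y. y 0 = a}" by (auto simp: window_def agree_def)
    then show "closedin Y.XT {y \<in> Y. y 0 = a}" by (rule Y.window_imp_clopen)
    show "(\<lambda>y. sh (int j) (E y)) ` {y \<in> Y. y 0 = a} \<subseteq> topspace (full_shift A)"
      using EX sh_in_X X_sub by blast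
    fix m
    have "agree m (sh (int j) (E y)) (sh (int j) (E y'))"
      if "y \<in> Y" "y' \<in> Y" "agree (m + nat \<bar>int j\<bar>) y y'" for y y'
      using that unfolding E_def by (intro agree_sh agree_morphism_ext ne) auto
    then show "\<exists>M. \<forall>y\<in>{y \<in> Y. y 0 = a}. \<forall>y'\<in>{y \<in> Y. y 0 = a}. agree M y y' \<longrightarrow>
        agree m (sh (int j) (E y)) (sh (int j) (E y'))" by blast
  qed
  have R_closed: "closedin XT (R k)" for k
  proof -
    have "closedin (full_shift A) (R k)"
      unfolding R_eq using Y.finite_A by (auto intro!: closedin_Union piece)
    then show ?thesis using R_X by (simp add: closedin_closed_subtopology[OF closedin_X])
  qed
  have Y_ne: "Y \<noteq> {}"
  proof
    assume "Y = {}"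
    moreover have "subshift A {}" using finite_A by (simp add: subshift_def)
    ultimately have "X = {}" using sm unfolding smallest_subshift_def by blast
    then show False using infinite_X by simp
  qed
  \<comment> \<open>The points at any offset already form a nonempty closed set. It is invariant,
    since stepping over either end of a word lands in the neighbouring word; minimality does the
    rest.\<close>
  have "R 0 = X"
  proof (rule minimalD[OF R_closed])
    obtain y where "y \<in> Y" using Y_ne by blast
    then have "sh (int 0) (E y) \<in> R 0" using ne[of y 0] unfolding R_def by blast
    then show "R 0 \<noteq> {}" by blast
  next
    fix x assume "x \<in> R 0"
    then obtain j y where x: "x = sh (int j) (E y)" and y: "y \<in> Y" and j: "j < length (\<tau> (y 0))"
      unfolding R_def by blast
    have c1: "cut \<tau> y 1 = int (length (\<tau> (y 0)))" using cut_step[of \<tau> y 0] by (simp add: cut_0)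
    show "sh 1 x \<in> R 0"
    proof (cases "Suc j < length (\<tau> (y 0))")
      case True
      then have "sh (int (Suc j)) (E y) \<in> R 0" using y unfolding R_def by blast
      then show ?thesis by (simp add: x)
    next
      case False
      then have "1 + int j = int (length (\<tau> (y 0)))" using j by linarith
      then have "sh 1 x = sh (int 0) (E (sh 1 y))" using y by (simp add: x Esh c1)
      then show ?thesis using y ne[of "sh 1 y" 0] unfolding R_def mem_Collect_eq
        by (intro exI[of _ 0] exI[of _ "sh 1 y"]) simp
    qed
    show "sh (-1) x \<in> R 0"
    proof (cases j)
      case (Suc i)
      then have "sh (int i) (E y) \<in> R 0" using y j Suc by (intro RI) auto
      then show ?thesis by (simp add: x Suc)
    next
      case 0
      have c: "cut \<tau> y (-1) = - int (length (\<tau> (y (-1))))" using cut_step[of \<tau> y "-1"] by (simp add: cut_0)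
      have l: "length (\<tau> (y (-1))) \<ge> 1" using ne[OF y, of "-1"] by (simp add: Suc_le_eq)
      then have "sh (-1) x = sh (int (length (\<tau> (y (-1))) - 1)) (E (sh (-1) y))"
        using y by (simp add: x 0 Esh c of_nat_diff)
      then show ?thesis using y l unfolding R_def mem_Collect_eq
        by (intro exI[of _ "length (\<tau> (y (-1))) - 1"] exI[of _ "sh (-1) y"])
          (simp add: sh_apply[of "-1" y 0])
    qed
  qed
  define C where "C = E ` Y"
  have CX: "C \<subseteq> X" using EX by (auto simp: C_def)
  have "C = X - R 1"
  proof -
    have "R 0 = C \<union> R 1"
    proof -
      have "x \<in> C" if "x = sh (int 0) (E y)" "y \<in> Y" for x y using that by (simp add: C_def)
      moreover have "E y \<in> R 0" if "y \<in> Y" for y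
        using that ne[of y 0] unfolding R_def mem_Collect_eq by (intro exI[of _ 0] exI[of _ y]) simp
      moreover have "R 1 \<subseteq> R 0" unfolding R_def by auto
      moreover have "x \<in> C \<union> R 1" if xR: "x \<in> R 0" for x
      proof -
        obtain j y where x: "x = sh (int j) (E y)" "y \<in> Y" "j < length (\<tau> (y 0))"
          using xR unfolding R_def by blast
        show ?thesis
        proof (cases j)
          case 0 then show ?thesis using x by (simp add: C_def)
        next
          case (Suc i) then have "1 \<le> j" by simp
          then show ?thesis using x unfolding R_def by blast
        qed
      qed
      ultimately show ?thesis unfolding C_def by blast
    qed
    moreover have "C \<inter> R 1 = {}"
    proof -
      have False if y: "y \<in> Y" "y' \<in> Y" and "E y = sh (int j) (E y')" "1 \<le> j" "j < length (\<tau> (y' 0))" for y y' j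
        using uniq[of y y' 0 j] that ne[OF y(1), of 0] by simp
      then show ?thesis unfolding C_def R_def by blast
    qed
    ultimately show ?thesis using \<open>R 0 = X\<close> by blast
  qed
  then have "openin XT C"
    using R_closed[of 1] by (metis openin_diff openin_topspace topspace_XT)
  moreover have "closedin XT C"
  proof -
    have "closedin (full_shift A) (E ` Y)"
    proof (rule Y.closedin_image)
      show "closedin Y.XT Y" by (metis closedin_topspace Y.topspace_XT)
      show "E ` Y \<subseteq> topspace (full_shift A)" using EX X_sub by blast
      fix m show "\<exists>M. \<forall>x\<in>Y. \<forall>y\<in>Y. agree M x y \<longrightarrow> agree m (E x) (E y)"
        unfolding E_def using agree_morphism_ext[of \<tau> _ _ m] ne by blast
    qed
    then show ?thesis using CX by (simp add: C_def closedin_closed_subtopology[OF closedin_X])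
  qed
  ultimately obtain m where m: "window X m C" using clopen_imp_window by blast
  \<comment> \<open>Cutting points carry the first letter of a word at coordinate 0. The base of a
    tower is its last level, so \<open>D\<close> is moved one step back: at a point of
    \<open>D\<close>, coordinate 0 carries the last letter of the preceding word.\<close>
  define D where "D = {x \<in> X. sh 1 x \<in> C}"
  have "window X (m + nat \<bar>1\<bar>) D" unfolding D_def using m by (rule window_preimage)
  moreover have "D \<noteq> {}"
  proof -
    obtain y where "y \<in> Y" using Y_ne by blast
    then have "sh (-1) (E y) \<in> D" using EX by (simp add: D_def C_def)
    then show ?thesis by blast
  qed
  moreover have "\<exists>h\<ge>1. sh (- int h) x \<in> D \<and>
       (\<forall>t. 0 < t \<and> t < h \<longrightarrow> sh (- int t) x \<notin> D) \<and> factor x (1 - int h) h \<in> W" if xD: "x \<in> D" for x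
  proof -
    from xD obtain y where y: "y \<in> Y" and x1: "sh 1 x = E y" unfolding D_def C_def by blast
    have x: "x = sh (-1) (E y)" by (simp flip: x1)
    define z where "z = sh (-1) y"
    define h where "h = length (\<tau> (z 0))"
    have z: "z \<in> Y" using y by (simp add: z_def)
    have c: "cut \<tau> z 1 = int h" using cut_step[of \<tau> z 0] by (simp add: cut_0 h_def)
    have "y = sh 1 z" by (simp add: z_def)
    then have Ey: "E y = sh (int h) (E z)" using Esh[OF z, of 1] c by simp
    have h1: "1 \<le> h" using ne[OF z, of 0] by (simp add: h_def Suc_le_eq)
    have "sh (- int h) x \<in> D" using y z EX by (simp add: D_def C_def x Ey)
    \<comment> \<open>An intermediate visit would give one point of \<open>X\<close> both the offset
      \<open>h - t\<close> inside \<open>\<tau> (z 0)\<close> and the offset 0.\<close>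
    moreover have "sh (- int t) x \<notin> D" if t: "0 < t" "t < h" for t
    proof
      assume "sh (- int t) x \<in> D"
      then obtain y' where y': "y' \<in> Y" "sh (- int t) (E y) = E y'" by (auto simp: D_def C_def x)
      then have "sh (int (h - t)) (E z) = sh (int 0) (E y')"
        using t by (simp add: Ey of_nat_diff)
      moreover have "h - t < length (\<tau> (z 0))" using t unfolding h_def[symmetric] by linarith
      moreover have "0 < length (\<tau> (y' 0))" using ne[OF y'(1), of 0] by simp
      ultimately have "h - t = 0" by (rule uniq[OF z y'(1)])
      then show False using t by simp
    qed
    moreover have "factor x (1 - int h) h = \<tau> (z 0)"
    proof -
      have "factor x (1 - int h) h = factor (E z) (cut \<tau> z 0) h"
        unfolding factor_def x Ey sh_apply cut_0 by (intro map_cong) (auto simp: algebra_simps)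
      then show ?thesis unfolding h_def E_def using factor_morphism_ext[of \<tau> z 0] ne[OF z] by simp
    qed
    moreover have "\<tau> (z 0) \<in> W" using Y.X_A[OF z, of 0] W by blast
    ultimately show ?thesis using h1 by auto
  qed
  ultimately show ?thesis using that by blast
qed

end

section \<open>Partitions from return times\<close>

context infinite_minimal
begin

lemma preim_eq: "preim XT shift j B = {x \<in> X. sh (int j) x \<in> B}"
  unfolding preim_def topspace_XT shift_funpow ..

text \<open>One tower per value of \<open>g\<close>: since \<open>g\<close> determines the return
  time into the past, each fibre can serve as the base of a tower of constant height. A point of
  \<open>X\<close> lies on level \<open>j\<close>, where \<open>j\<close> is the time of its first
  forward visit to \<open>D\<close>. Such a visit exists because a fibre of \<open>g\<close> is a
  nonempty clopen set.\<close>

lemma CKR_of_returns: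
  assumes DX: "D \<subseteq> X" and D_ne: "D \<noteq> {}"
    and ht: "\<And>x. x \<in> D \<Longrightarrow> 1 \<le> ht x" "\<And>x. x \<in> D \<Longrightarrow> sh (- int (ht x)) x \<in> D"
      "\<And>x t. x \<in> D \<Longrightarrow> 0 < t \<Longrightarrow> t < ht x \<Longrightarrow> sh (- int t) x \<notin> D"
    and fin: "finite (g ` D)"
    and fib: "\<And>l. l \<in> g ` D \<Longrightarrow> \<exists>M. window X M {x \<in> D. g x = l}"
    and hg: "\<And>x y. x \<in> D \<Longrightarrow> y \<in> D \<Longrightarrow> g x = g y \<Longrightarrow> ht x = ht y"
  obtains B h where "CKR_partition XT shift (card (g ` D)) B h" "base (card (g ` D)) B = D"
    "\<And>k. k \<in> {1..card (g ` D)} \<Longrightarrow> B k \<noteq> {}"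
    "\<And>k x. k \<in> {1..card (g ` D)} \<Longrightarrow> x \<in> B k \<Longrightarrow> x \<in> D \<and> ht x = h k"
    "\<And>k x y. k \<in> {1..card (g ` D)} \<Longrightarrow> x \<in> B k \<Longrightarrow> y \<in> B k \<Longrightarrow> g x = g y"
proof -
  let ?d = "card (g ` D)"
  obtain e where e: "bij_betw e {1..?d} (g ` D)" using ex_bij_betw_nat_finite_1[OF fin] by blast
  define B where "B k = {x \<in> D. g x = e k}" for k
  define h where "h k = ht (SOME x. x \<in> B k)" for k
  have B_ne: "B k \<noteq> {}" if "k \<in> {1..?d}" for k
  proof -
    have "e k \<in> g ` D" using bij_betw_apply[OF e that] .
    then show ?thesis by (auto simp: B_def)
  qed
  have hB: "x \<in> D \<and> ht x = h k" if "x \<in> B k" for x k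
  proof -
    have "(SOME x. x \<in> B k) \<in> B k" using that by (rule someI[of "\<lambda>x. x \<in> B k"])
    then show ?thesis using that hg unfolding h_def B_def by auto
  qed
  have D_B: "\<exists>k\<in>{1..?d}. x \<in> B k" if "x \<in> D" for x
  proof -
    have "g x \<in> e ` {1..?d}" using e that by (auto simp: bij_betw_def)
    then show ?thesis using that by (auto simp: B_def)
  qed
  have base_D: "base ?d B = D"
    unfolding base_def
  proof (intro equalityI subsetI)
    fix x assume "x \<in> D" then show "x \<in> \<Union> (B ` {1..?d})" using D_B by blast
  qed (auto simp: B_def)
  have hit: "\<exists>j. sh (int j) x \<in> D \<and> (\<forall>i<j. sh (int i) x \<notin> D)" if x: "x \<in> X" for x
  proof -
    obtain z where z: "z \<in> D" using D_ne by blast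
    then obtain M where "window X M {y \<in> D. g y = g z}" using fib by blast
    then have "openin XT {y \<in> D. g y = g z}" by (rule window_imp_clopen)
    then obtain j where "sh (int j) x \<in> D" using visits[of "{y \<in> D. g y = g z}"] z x by blast
    then show ?thesis using LeastI[of "\<lambda>j. sh (int j) x \<in> D"] not_less_Least by blast
  qed
  have disj: "(k, j) = (k', j')"
    if l: "(k, j) \<in> levels ?d h" "(k', j') \<in> levels ?d h"
      and x: "sh (int j) x \<in> B k" "sh (int j') x \<in> B k'" for k j k' j' x
  proof -
    have no: False if "j < j'" "j' < h k'" "sh (int j) x \<in> B k" "sh (int j') x \<in> B k'" for j j' k k'
    proof -
      have "sh (- int (j' - j)) (sh (int j') x) = sh (int j) x" using that(1) by (simp add: of_nat_diff)
      then have "sh (- int (j' - j)) (sh (int j') x) \<in> D" using hB[OF that(3)] by simp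
      then show False using ht(3)[of "sh (int j') x" "j' - j"] hB[OF that(4)] that(1)
        less_imp_diff_less[OF that(2), of j] by auto
    qed
    have "j < h k" "j' < h k'" using l by (auto simp: levels_def)
    then have j: "j = j'" using no[of j j' k' k] no[of j' j k k'] x by (meson linorder_neqE_nat)
    then have "e k = e k'" using x by (simp add: B_def)
    moreover have "k \<in> {1..?d}" "k' \<in> {1..?d}" using l by (auto simp: levels_def)
    ultimately have "k = k'" by (rule inj_onD[OF bij_betw_imp_inj_on[OF e]])
    then show ?thesis using j by simp
  qed
  have "CKR_partition XT shift ?d B h"
    unfolding CKR_partition_def
  proof (intro conjI ballI)
    fix k assume k: "k \<in> {1..?d}"
    have "e k \<in> g ` D" using bij_betw_apply[OF e k] .
    then obtain M where M: "window X M (B k)" using fib unfolding B_def by blast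
    show "openin XT (B k)" "closedin XT (B k)" using window_imp_clopen[OF M] by simp_all
    obtain x where "x \<in> B k" using B_ne[OF k] by blast
    then show "1 \<le> h k" using hB ht(1) by metis
  next
    show "disjoint_family_on (\<lambda>(k, j). preim XT shift j (B k)) (levels ?d h)"
      unfolding disjoint_family_on_def preim_eq using disj by fastforce
  next
    show "partition_on (topspace XT) (atoms XT shift ?d B h)"
    proof (rule partition_onI)
      have "x \<in> \<Union> (atoms XT shift ?d B h)" if x: "x \<in> X" for x
      proof -
        obtain j where j: "sh (int j) x \<in> D" "\<And>i. i < j \<Longrightarrow> sh (int i) x \<notin> D" using hit[OF x] by blast
        obtain k where k: "k \<in> {1..?d}" "sh (int j) x \<in> B k" using D_B[OF j(1)] by blast
        have "j < h k"
        proof (rule ccontr)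
          assume "\<not> j < h k"
          moreover have "ht (sh (int j) x) = h k" "1 \<le> h k" using hB[OF k(2)] ht(1) by metis+
          ultimately have "sh (int (j - h k)) x \<in> D" "j - h k < j"
            using ht(2)[OF j(1)] by (auto simp: of_nat_diff)
          then show False using j(2) by blast
        qed
        then have "(k, j) \<in> levels ?d h" "x \<in> preim XT shift j (B k)"
          using k x by (auto simp: levels_def preim_eq)
        then show ?thesis unfolding atoms_def by blast
      qed
      then show "\<Union> (atoms XT shift ?d B h) = topspace XT"
        unfolding atoms_def preim_eq topspace_XT by auto
    next
      have "P \<noteq> {}" if "P \<in> atoms XT shift ?d B h" for P
      proof -
      from that obtain k j where P: "P = {x \<in> X. sh (int j) x \<in> B k}" "k \<in> {1..?d}"
        by (auto simp: atoms_def levels_def preim_eq)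
      obtain z where "z \<in> B k" using B_ne[OF P(2)] by blast
      then have "sh (- int j) z \<in> P" using P hB DX by auto
      then show "P \<noteq> {}" by blast
      qed
      then show "{} \<notin> atoms XT shift ?d B h" by blast
    next
      fix P Q assume PQ: "P \<in> atoms XT shift ?d B h" "Q \<in> atoms XT shift ?d B h" "P \<noteq> Q"
      from PQ(1) obtain k j where 1: "(k, j) \<in> levels ?d h" "P = {x \<in> X. sh (int j) x \<in> B k}"
        by (auto simp: atoms_def preim_eq)
      from PQ(2) obtain k' j' where 2: "(k', j') \<in> levels ?d h" "Q = {x \<in> X. sh (int j') x \<in> B k'}"
        by (auto simp: atoms_def preim_eq)
      show "disjnt P Q"
        unfolding disjnt_def using disj[OF 1(1) 2(1)] 1(2) 2(2) PQ(3) by blast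
    qed
  next
    have "x \<in> D" if "k \<in> {1..?d}" "x \<in> X" "sh (int (h k)) x \<in> B k" for k x
      using ht(2)[of "sh (int (h k)) x"] hB[OF that(3)] by simp
    \<comment> \<open>The next visit \<open>z\<close> after \<open>x\<close> must have return time
      exactly \<open>Suc j\<close>: a longer one would pass over the visit at \<open>x\<close>, a
      shorter one would contradict the choice of \<open>j\<close>.\<close>
    moreover have "\<exists>k\<in>{1..?d}. sh (int (h k)) x \<in> B k" if x: "x \<in> D" for x
    proof -
      have "sh 1 x \<in> X" using x DX by auto
      then obtain j where j: "sh (int j) (sh 1 x) \<in> D" "\<And>i. i < j \<Longrightarrow> sh (int i) (sh 1 x) \<notin> D"
        using hit by blast
      define z where "z = sh (int j) (sh 1 x)"
      have zx: "sh (- int t) z = sh (int (Suc j) - int t) x" for t by (simp add: z_def algebra_simps)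
      have z: "z \<in> D" using j by (simp add: z_def)
      have "sh (- int (Suc j)) z \<in> D" using x unfolding zx by simp
      then have "\<not> Suc j < ht z" using ht(3)[OF z, of "Suc j"] by blast
      moreover have "\<not> ht z < Suc j"
      proof
        assume "ht z < Suc j"
        then have "sh (int (j - ht z)) (sh 1 x) = sh (- int (ht z)) z" "j - ht z < j"
          using ht(1)[OF z] by (auto simp: zx of_nat_diff algebra_simps)
        then show False using ht(2)[OF z] j(2) by metis
      qed
      ultimately have "ht z = Suc j" by simp
      moreover obtain k where k: "k \<in> {1..?d}" "z \<in> B k" using D_B[OF z] by blast
      ultimately have "h k = Suc j" using hB[OF k(2)] by simp
      then have "sh (int (h k)) x = z" by (simp add: z_def add.commute)
      then show ?thesis using k by blast
    qed
    ultimately have "(\<Union>k\<in>{1..?d}. preim XT shift (h k) (B k)) = D"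
      unfolding preim_eq using DX by blast
    then show "(\<Union>k\<in>{1..?d}. preim XT shift (h k) (B k)) = base ?d B"
      using base_D by simp
  qed
  then show thesis
  proof (rule that[OF _ base_D B_ne])
    fix k x y assume "x \<in> B k" "y \<in> B k" then show "g x = g y" by (simp add: B_def)
  qed (use hB in auto)
qed

text \<open>What the construction needs from a recognizable set of words of length at least
  \<open>N\<close>: a clopen base and its return words, without the coding subshift. The bound
  \<open>r\<close> will be the same for all \<open>N\<close>, while \<open>W\<close>,
  \<open>M\<close> and \<open>D\<close> may change with it.\<close>

definition long_returns :: "nat \<Rightarrow> nat \<Rightarrow> bool" where
  "long_returns r N \<longleftrightarrow> (\<exists>W M D. finite W \<and> card W \<le> r \<and> D \<noteq> {} \<and> window X M D \<and>
         (\<forall>w\<in>W. N \<le> length w) \<and>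
         (\<forall>x\<in>D. \<exists>h\<ge>1. sh (- int h) x \<in> D \<and> (\<forall>t. 0 < t \<and> t < h \<longrightarrow> sh (- int t) x \<notin> D) \<and>
            factor x (1 - int h) h \<in> W))"

text \<open>The new base consists of the first visits to \<open>U\<close> after the visits to \<open>D\<close>. The gaps between
  visits to \<open>D\<close> being long, a point of the new base is determined, up to \<open>m\<close> coordinates beyond its
  return, by three consecutive return words of \<open>D\<close>: hence at most \<open>r ^ 3\<close> towers, however fine
  the partition that has to be refined.\<close>

lemma refining_partition:
  assumes returns: "\<And>N. long_returns r N"
    and U: "window X m U" "U \<noteq> {}"
  shows "\<exists>d B h. d \<le> r ^ 3 \<and> CKR_partition XT shift d B h \<and> base d B \<subseteq> U \<and> base d B \<noteq> {} \<and>
      (\<forall>k\<in>{1..d}. n \<le> h k) \<and> (\<forall>P\<in>atoms XT shift d B h. \<forall>x\<in>P. \<forall>y\<in>P. agree m x y)"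
proof -
  have "openin XT U" using U(1) by (rule window_imp_clopen)
  from visits[OF this U(2)] obtain G where G: "\<forall>x\<in>X. \<exists>j\<le>G. sh (int j) x \<in> U" by blast
  define f where "f x = (LEAST j. sh (int j) x \<in> U)" for x
  have f: "sh (int (f x)) x \<in> U" "f x \<le> G" if x: "x \<in> X" for x
  proof -
    obtain j where "j \<le> G" "sh (int j) x \<in> U" using G x by blast
    then show "sh (int (f x)) x \<in> U" "f x \<le> G"
      unfolding f_def by (auto intro: LeastI Least_le order_trans)
  qed
  \<comment> \<open>Exceeding \<open>G + m\<close> lets a neighbouring return word contain a delay
    and its margin, and determine that delay through the window of \<open>U\<close>. Exceeding
    \<open>G + n\<close> leaves heights above \<open>n\<close> after the delays, and exceeding
    \<open>G\<close> keeps delayed visits apart and in order.\<close>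
  define N where "N = n + 2 * G + m + 1"
  obtain W M D where W: "finite W" "card W \<le> r" "\<And>w. w \<in> W \<Longrightarrow> N \<le> length w"
    and D: "D \<noteq> {}" "window X M D"
    and ex: "\<And>x. x \<in> D \<Longrightarrow> \<exists>h\<ge>1. sh (- int h) x \<in> D \<and>
        (\<forall>t. 0 < t \<and> t < h \<longrightarrow> sh (- int t) x \<notin> D) \<and> factor x (1 - int h) h \<in> W"
    using returns[of N] unfolding long_returns_def by blast
  have DX: "D \<subseteq> X" using D(2) by (simp add: window_def)
  define a where "a x = (SOME h. h \<ge> 1 \<and> sh (- int h) x \<in> D \<and>
        (\<forall>t. 0 < t \<and> t < h \<longrightarrow> sh (- int t) x \<notin> D) \<and> factor x (1 - int h) h \<in> W)" for x
  define wd where "wd x = factor x (1 - int (a x)) (a x)" for x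
  define prev where "prev x = sh (- int (a x)) x" for x
  have a: "a x \<ge> 1" "prev x \<in> D" "\<And>t. 0 < t \<Longrightarrow> t < a x \<Longrightarrow> sh (- int t) x \<notin> D" "wd x \<in> W"
    if "x \<in> D" for x
    unfolding prev_def wd_def using someI_ex[OF ex[OF that], folded a_def] by blast+
  have len_wd: "length (wd x) = a x" for x by (simp add: wd_def factor_def)
  have aN: "N \<le> a x" if "x \<in> D" for x using a(4)[OF that] W(3) len_wd by metis
  have a_eqI: "a x = h"
    if "x \<in> D" "h \<ge> 1" "sh (- int h) x \<in> D" "\<And>t. 0 < t \<Longrightarrow> t < h \<Longrightarrow> sh (- int t) x \<notin> D" for x h
  proof -
    have "\<not> h < a x" using a(3)[OF that(1), of h] that(2,3) by auto
    moreover have "\<not> a x < h" using a(1,2)[OF that(1)] that(4)[of "a x"] by (auto simp: prev_def)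
    ultimately show ?thesis by simp
  qed
  have wd_nth: "x i = wd x ! nat (i + int (a x) - 1)" if "- int (a x) < i" "i \<le> 0" for x i
  proof -
    have "nat (i + int (a x) - 1) < a x" using that by linarith
    then show ?thesis using that by (simp add: wd_def factor_def)
  qed
  have gap: "int N \<le> \<bar>s\<bar>" if p: "p \<in> D" "sh s p \<in> D" and "s \<noteq> 0" for p s
  proof (cases "0 < s")
    case True
    then have "sh (- int (nat s)) (sh s p) = p" by simp
    then have "\<not> nat s < a (sh s p)" using a(3)[OF p(2), of "nat s"] True p(1) by auto
    then show ?thesis using aN[OF p(2)] by linarith
  next
    case False
    then have "sh (- int (nat (- s))) p = sh s p" by simp
    then have "\<not> nat (- s) < a p" using a(3)[OF p(1), of "nat (- s)"] False p(2) that(3) by auto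
    then show ?thesis using aN[OF p(1)] by linarith
  qed
  have NG: "G + m < N" "2 * G < N" "G + n < N" by (simp_all add: N_def)

  \<comment> \<open>The delayed visit of \<open>prev q\<close>, not of \<open>q\<close>, is indexed
    by \<open>q\<close>: then the delay and the right margin lie inside the word
    \<open>wd q\<close>, which ends at \<open>q\<close>, and the whole label is read from the past
    of \<open>q\<close>.\<close>
  define \<phi> where "\<phi> q = sh (int (f (prev q))) (prev q)" for q
  define lab where "lab q = (wd q, wd (prev q), wd (prev (prev q)))" for q
  define c where "c q = int (f (prev q)) - int (a q)" for q
  define ht where "ht q = f (prev q) + a (prev q) - f (prev (prev q))" for q
  have \<phi>_c: "\<phi> q = sh (c q) q" for q by (simp add: \<phi>_def c_def prev_def)
  have \<phi>_U: "\<phi> q \<in> U" if "q \<in> D" for q unfolding \<phi>_def using f(1) a(2)[OF that] DX by blast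
  have inj: "inj_on \<phi> D"
  proof (rule inj_onI)
    fix q q' assume q: "q \<in> D" "q' \<in> D" "\<phi> q = \<phi> q'"
    define p p' where "p = prev q" and "p' = prev q'"
    have p: "p \<in> D" "p' \<in> D" using q a(2) by (auto simp: p_def p'_def)
    have pp': "p = sh (int (f p') - int (f p)) p'"
    proof -
      have "sh (- int (f p)) (\<phi> q) = sh (- int (f p)) (\<phi> q')" using q by simp
      then show ?thesis by (simp add: \<phi>_def p_def p'_def)
    qed
    have "f p \<le> G" "f p' \<le> G" using f p DX by auto
    then have "int (f p') - int (f p) = 0"
      using gap[of p' "int (f p') - int (f p)"] p pp' NG by force
    then have "p = p'" using pp' by simp
    then have "sh (int (a q)) (prev q) = sh (int (a q)) (prev q')" by (simp add: p_def p'_def)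
    then have qq': "q = sh (int (a q) - int (a q')) q'" by (simp add: prev_def)
    have "sh (int (a q') - int (a q)) (sh (int (a q) - int (a q')) q') = q'" by simp
    then have qq: "q' = sh (int (a q') - int (a q)) q" unfolding qq'[symmetric] by (rule sym)
    \<comment> \<open>Both \<open>q\<close> and \<open>q'\<close> are the first visit to
      \<open>D\<close> after the common point \<open>prev q\<close>; the later one would otherwise
      have the earlier one as an intermediate visit.\<close>
    have "a q = a q'"
    proof (rule ccontr)
      assume ne: "a q \<noteq> a q'"
      show False
      proof (cases "a q < a q'")
        case True
        then have "q = sh (- int (a q' - a q)) q'" using qq' by (simp add: of_nat_diff)
        then show False using a(3)[OF q(2), of "a q' - a q"] a(1)[OF q(1)] True q(1) by auto
      next
        case False
        then have "q' = sh (- int (a q - a q')) q" using qq by (simp add: of_nat_diff)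
        then show False using a(3)[OF q(1), of "a q - a q'"] a(1)[OF q(2)] False ne q(2) by auto
      qed
    qed
    then show "q = q'" using qq' by simp
  qed
  \<comment> \<open>The label fixes \<open>a0 + a1 + a2\<close> coordinates up to and including
    coordinate 0 of \<open>q\<close>. The delay from \<open>prev q\<close> is decided by
    \<open>wd (prev q)\<close> and \<open>wd q\<close>, the delay from \<open>prev (prev q)\<close>
    by \<open>wd (prev (prev q))\<close> and \<open>wd (prev q)\<close>. With both delays known, the
    stretch between the two delayed visits and its margins of \<open>m\<close> coordinates fall
    within the fixed range.\<close>
  have lab_agree: "c q = c q' \<and> ht q = ht q' \<and>
      (\<forall>i. - int (ht q) - int m \<le> i \<and> i \<le> int m \<longrightarrow> \<phi> q i = \<phi> q' i)"
    if q: "q \<in> D" "q' \<in> D" and lab: "lab q = lab q'" for q q'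
  proof -
    have wd: "wd q = wd q'" "wd (prev q) = wd (prev q')" "wd (prev (prev q)) = wd (prev (prev q'))"
      using lab by (simp_all add: lab_def)
    then have aa: "a q = a q'" "a (prev q) = a (prev q')" "a (prev (prev q)) = a (prev (prev q'))"
      by (metis len_wd)+
    define a0 a1 a2 where "a0 = int (a q)" "a1 = int (a (prev q))" "a2 = int (a (prev (prev q)))"
    have N: "int N \<le> a0" "int N \<le> a1" "int N \<le> a2"
      using aN q a(2) by (auto simp: a0_a1_a2_def)
    have same: "q i = q' i" if i: "- (a0 + a1 + a2) < i" "i \<le> 0" for i
    proof -
      consider "- a0 < i" | "i \<le> - a0" "- (a0 + a1) < i" | "i \<le> - (a0 + a1)" by linarith
      then show ?thesis
      proof cases
        case 1
        then show ?thesis using i wd_nth[of q i] wd_nth[of q' i] wd aa by (simp add: a0_a1_a2_def)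
      next
        case 2
        then have "prev q (i + a0) = prev q' (i + a0)"
          using wd_nth[of "prev q" "i + a0"] wd_nth[of "prev q'" "i + a0"] wd aa by (simp add: a0_a1_a2_def)
        then show ?thesis by (simp add: prev_def sh_apply aa a0_a1_a2_def)
      next
        case 3
        then have "prev (prev q) (i + a0 + a1) = prev (prev q') (i + a0 + a1)"
          using i wd_nth[of "prev (prev q)" "i + a0 + a1"] wd_nth[of "prev (prev q')" "i + a0 + a1"] wd aa
          by (simp add: a0_a1_a2_def)
        moreover have "prev (prev x) (i + int (a x) + int (a (prev x))) = x i" for x
          unfolding prev_def[of "prev x"] sh_apply[of _ "prev x"] unfolding prev_def sh_apply by simp
        ultimately show ?thesis using aa by (metis a0_a1_a2_def(1,2))
      qed
    qed
    have p: "prev q i = prev q' i" if "- (a1 + a2) < i" "i \<le> a0" for i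
      using same[of "i - a0"] that by (simp add: prev_def sh_apply aa a0_a1_a2_def)
    have pp: "prev (prev q) i = prev (prev q') i" if "- a2 < i" "i \<le> a0 + a1" for i
      using p[of "i - a1"] that unfolding prev_def[of "prev q"] prev_def[of "prev q'"]
      by (simp add: sh_apply aa a0_a1_a2_def)
    have f_eq: "f x = f x'"
      if x: "x \<in> X" "x' \<in> X" and eq: "\<And>i. - int N < i \<Longrightarrow> i \<le> int N \<Longrightarrow> x i = x' i" for x x'
    proof -
      have U_eq: "sh (int j) x \<in> U \<longleftrightarrow> sh (int j) x' \<in> U" if "j \<le> G" for j
      proof (rule windowD[OF U(1)])
        show "agree m (sh (int j) x) (sh (int j) x')"
          unfolding agree_def sh_apply using eq that NG by auto
      qed (use x in simp_all)
      have "f x \<le> f x'" using f[OF x(2)] U_eq[of "f x'"] unfolding f_def by (intro Least_le) simp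
      moreover have "f x' \<le> f x" using f[OF x(1)] U_eq[of "f x"] unfolding f_def by (intro Least_le) simp
      ultimately show ?thesis by simp
    qed
    have PX: "prev q \<in> X" "prev q' \<in> X" "prev (prev q) \<in> X" "prev (prev q') \<in> X"
      using a(2) q DX by blast+
    have f1: "f (prev q) = f (prev q')" by (rule f_eq) (use PX p N in auto)
    have f2: "f (prev (prev q)) = f (prev (prev q'))" by (rule f_eq) (use PX pp N in auto)
    have "f (prev q) \<le> G" "f (prev (prev q)) \<le> G" using f(2) PX by auto
    then have "\<phi> q i = \<phi> q' i" if "- int (ht q) - int m \<le> i" "i \<le> int m" for i
      using p[of "i + int (f (prev q))"] that N NG f1
      unfolding \<phi>_def sh_apply ht_def a0_a1_a2_def by auto
    then show ?thesis using f1 f2 aa by (simp add: c_def ht_def)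
  qed
  note lab_c = lab_agree[THEN conjunct1] and lab_ht = lab_agree[THEN conjunct2, THEN conjunct1]
  have ret: "n + 1 \<le> ht q" "sh (- int (ht q)) (\<phi> q) = \<phi> (prev q)"
      "\<And>t. 0 < t \<Longrightarrow> t < ht q \<Longrightarrow> sh (- int t) (\<phi> q) \<notin> \<phi> ` D"
    if q: "q \<in> D" for q
  proof -
    define p where "p = prev q"
    have p: "p \<in> D" "prev p \<in> D" using a(2) q by (auto simp: p_def)
    have fG: "f p \<le> G" "f (prev p) \<le> G" using f(2) p DX by auto
    have hp: "int (ht q) = int (f p) + int (a p) - int (f (prev p))"
      using fG aN[OF p(1)] NG by (simp add: ht_def p_def)
    then show "n + 1 \<le> ht q" using fG aN[OF p(1)] NG by linarith
    have "sh (- int (ht q)) (\<phi> q) = sh (int (f (prev p)) - int (a p)) p"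
      by (simp add: \<phi>_def hp flip: p_def)
    also have "\<dots> = \<phi> (prev q)" by (simp add: \<phi>_def prev_def[of p] flip: p_def)
    finally show "sh (- int (ht q)) (\<phi> q) = \<phi> (prev q)" .
    fix t assume t: "0 < t" "t < ht q"
    show "sh (- int t) (\<phi> q) \<notin> \<phi> ` D"
    proof
      assume "sh (- int t) (\<phi> q) \<in> \<phi> ` D"
      then obtain q2 where q2: "q2 \<in> D" "sh (- int t) (\<phi> q) = \<phi> q2" by blast
      define p2 where "p2 = prev q2"
      have p2: "p2 \<in> D" using a(2) q2 by (simp add: p2_def)
      have f2G: "f p2 \<le> G" using f(2) p2 DX by blast
      \<comment> \<open>The position relative to \<open>p\<close> of the visit \<open>p2\<close>
        whose delay would produce the intermediate visit. Since delays are at most \<open>G\<close>,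
        it cannot lie after \<open>p\<close>; it is neither \<open>p\<close> nor
        \<open>prev p\<close>, nor between them. So it lies at least \<open>N\<close> before
        \<open>prev p\<close>, too far to be delayed past the new visit belonging to
        \<open>prev p\<close>.\<close>
      define s where "s = int (f p) - int t - int (f p2)"
      have "sh (- int (f p2)) (sh (- int t) (\<phi> q)) = sh (- int (f p2)) (\<phi> q2)" using q2 by simp
      then have p2_s: "p2 = sh s p" by (simp add: \<phi>_def s_def flip: p_def p2_def)
      have p2_r: "p2 = sh (s + int (a p)) (prev p)" by (simp add: p2_s prev_def)
      have "s \<noteq> 0" using p2_s t by (auto simp: s_def)
      then have "int N \<le> \<bar>s\<bar>" using gap[of p s] p p2 p2_s by simp
      then have s: "int N \<le> - s" using NG fG by (simp add: s_def)
      have "s + int (a p) \<noteq> 0"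
      proof
        assume 0: "s + int (a p) = 0"
        then have "p2 = prev p" using p2_r by simp
        then show False using 0 t hp by (simp add: s_def)
      qed
      moreover have "\<not> s + int (a p) > 0"
      proof
        assume "s + int (a p) > 0"
        then have "0 < nat (- s)" "nat (- s) < a p" using s NG by auto
        then have "sh (- int (nat (- s))) p \<notin> D" by (rule a(3)[OF p(1)])
        then show False using p2 p2_s s by simp
      qed
      ultimately have "int N \<le> - (s + int (a p))"
        using gap[of "prev p" "s + int (a p)"] p p2 p2_r by simp
      then show False using t hp fG f2G NG by (simp add: s_def)
    qed
  qed

  \<comment> \<open>Labels belong to points of \<open>D\<close>, whereas the towers need labels on
    the new base; injectivity of \<open>\<phi>\<close> transports them.\<close>
  define \<psi> where "\<psi> = inv_into D \<phi>"
  have \<psi>: "\<psi> (\<phi> q) = q" if "q \<in> D" for q using inj that by (simp add: \<psi>_def)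
  define g where "g x = lab (\<psi> x)" for x
  have g_img: "g ` \<phi> ` D \<subseteq> W \<times> W \<times> W"
    using a by (auto simp: g_def \<psi> lab_def)
  have fin: "finite (g ` \<phi> ` D)" by (rule finite_subset[OF g_img]) (simp add: W(1))
  have "card (g ` \<phi> ` D) \<le> card (W \<times> W \<times> W)" using g_img W(1) by (intro card_mono) auto
  also have "\<dots> = card W ^ 3" by (simp add: card_cartesian_product power3_eq_cube)
  also have "\<dots> \<le> r ^ 3" using W(2) by (rule power_mono) simp
  finally have card: "card (g ` \<phi> ` D) \<le> r ^ 3" .
  define H where "H = Max (length ` W)"
  have aH: "a x \<le> H" if "x \<in> D" for x
    unfolding H_def len_wd[symmetric] using a(4)[OF that] W(1) by simp
  \<comment> \<open>Visits to \<open>D\<close> at the last \<open>H\<close> times determine the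
    return time, and \<open>H\<close> bounds every return time. Each step back to the previous visit
    therefore costs at most \<open>H\<close> of the radius, so a radius of \<open>M + 3 * H\<close>
    suffices for a label.\<close>
  have local: "y \<in> D \<and> wd y = wd x \<and> (agree (K + H) x y \<longrightarrow> agree K (prev x) (prev y))"
    if x: "x \<in> D" "y \<in> X" "agree (M + H) x y" for x y K
  proof -
    have in_D: "sh (- int t) y \<in> D \<longleftrightarrow> sh (- int t) x \<in> D" if "t \<le> H" for t
    proof (rule windowD[OF D(2), symmetric])
      have "agree (M + nat \<bar>- int t\<bar>) x y" using that by (intro agree_mono[OF x(3)]) simp
      then show "agree M (sh (- int t) x) (sh (- int t) y)" by (rule agree_sh)
    qed (use x DX in auto)
    have yD: "y \<in> D" using in_D[of 0] x by simp
    have ay: "a y = a x"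
    proof (rule a_eqI[OF yD])
      show "1 \<le> a x" using a(1)[OF x(1)] .
      show "sh (- int (a x)) y \<in> D" using in_D[of "a x"] aH[OF x(1)] a(2)[OF x(1)] by (simp add: prev_def)
      fix t assume "0 < t" "t < a x"
      then show "sh (- int t) y \<notin> D" using in_D[of t] aH[OF x(1)] a(3)[OF x(1)] by auto
    qed
    have "wd y = wd x"
      unfolding wd_def ay factor_def
    proof (rule map_cong[OF refl])
      fix j assume "j \<in> set [0..<a x]"
      then show "y (1 - int (a x) + int j) = x (1 - int (a x) + int j)"
        using x(3) aH[OF x(1)] by (auto simp: agree_def)
    qed
    moreover have "agree K (prev x) (prev y)" if "agree (K + H) x y"
      unfolding prev_def ay using agree_mono[OF that] aH[OF x(1)] by (intro agree_sh) simp
    ultimately show ?thesis using yD by blast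
  qed
  have lab_local: "y \<in> D \<and> lab y = lab x"
    if x: "x \<in> D" "y \<in> X" "agree (M + 3 * H) x y" for x y
  proof -
    have 1: "y \<in> D" "wd y = wd x" "agree (M + 2 * H) (prev x) (prev y)"
      using local[of x y "M + 2 * H"] x agree_mono[OF x(3)] by (auto simp: algebra_simps)
    have 2: "wd (prev y) = wd (prev x)" "agree (M + H) (prev (prev x)) (prev (prev y))"
      using local[of "prev x" "prev y" "M + H"] a(2) x(1) 1 DX agree_mono[OF 1(3)]
      by (auto simp: algebra_simps)
    have "wd (prev (prev y)) = wd (prev (prev x))"
      using local[of "prev (prev x)" "prev (prev y)"] a(2) x(1) 1(1) DX 2(2) by blast
    then show ?thesis using 1 2 by (simp add: lab_def)
  qed
  \<comment> \<open>The displacement \<open>c\<close> from \<open>q\<close> to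
    \<open>\<phi> q\<close> depends only on the label. A fibre on the new base is therefore a single
    translate of the clopen set of points of \<open>D\<close> with that label.\<close>
  have fib: "\<exists>M. window X M {x \<in> \<phi> ` D. g x = l}" if "l \<in> g ` \<phi> ` D" for l
  proof -
    obtain q0 where q0: "q0 \<in> D" "lab q0 = l" using \<open>l \<in> g ` \<phi> ` D\<close> by (auto simp: g_def \<psi>)
    define Dl where "Dl = {q \<in> D. lab q = l}"
    have "window X (M + 3 * H) Dl"
      unfolding window_def Dl_def using lab_local DX by blast
    then have "window X (M + 3 * H + nat \<bar>- c q0\<bar>) {x \<in> X. sh (- c q0) x \<in> Dl}"
      by (rule window_preimage)
    moreover have "{x \<in> \<phi> ` D. g x = l} = {x \<in> X. sh (- c q0) x \<in> Dl}"
    proof (intro equalityI subsetI)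
      fix x assume "x \<in> {x \<in> \<phi> ` D. g x = l}"
      then obtain q where q: "q \<in> D" "x = \<phi> q" "lab q = l" by (auto simp: g_def \<psi>)
      then have "c q = c q0" using lab_c[OF q(1) q0(1)] q0(2) by simp
      then show "x \<in> {x \<in> X. sh (- c q0) x \<in> Dl}" using q DX by (auto simp: \<phi>_c Dl_def)
    next
      fix x assume "x \<in> {x \<in> X. sh (- c q0) x \<in> Dl}"
      then have q: "sh (- c q0) x \<in> D" "lab (sh (- c q0) x) = l" by (auto simp: Dl_def)
      then have "c (sh (- c q0) x) = c q0" using lab_c[OF q(1) q0(1)] q0(2) by simp
      then have "\<phi> (sh (- c q0) x) = x" by (simp add: \<phi>_c)
      then show "x \<in> {x \<in> \<phi> ` D. g x = l}" using q
        by (auto simp: g_def \<psi> intro!: image_eqI[of x \<phi> "sh (- c q0) x"] dest: arg_cong[of _ _ \<psi>])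
    qed
    ultimately show ?thesis by metis
  qed
  obtain B h where P: "CKR_partition XT shift (card (g ` \<phi> ` D)) B h" "base (card (g ` \<phi> ` D)) B = \<phi> ` D"
    "\<And>k. k \<in> {1..card (g ` \<phi> ` D)} \<Longrightarrow> B k \<noteq> {}"
    "\<And>k x. k \<in> {1..card (g ` \<phi> ` D)} \<Longrightarrow> x \<in> B k \<Longrightarrow> x \<in> \<phi> ` D \<and> ht (\<psi> x) = h k"
    "\<And>k x y. k \<in> {1..card (g ` \<phi> ` D)} \<Longrightarrow> x \<in> B k \<Longrightarrow> y \<in> B k \<Longrightarrow> g x = g y"
  proof (rule CKR_of_returns[of "\<phi> ` D" "\<lambda>x. ht (\<psi> x)" g])
    show "\<phi> ` D \<subseteq> X" using DX by (auto simp: \<phi>_c)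
    show "\<phi> ` D \<noteq> {}" using D by simp
    show "1 \<le> ht (\<psi> x)" if "x \<in> \<phi> ` D" for x using that ret(1) by (fastforce simp: \<psi>)
    show "sh (- int (ht (\<psi> x))) x \<in> \<phi> ` D" if "x \<in> \<phi> ` D" for x
      using that ret(2) a(2) by (auto simp: \<psi>)
    show "sh (- int t) x \<notin> \<phi> ` D" if xt: "x \<in> \<phi> ` D" "0 < t" "t < ht (\<psi> x)" for x t
    proof -
      obtain q where "q \<in> D" "x = \<phi> q" using xt(1) by blast
      then show ?thesis using ret(3)[of q t] xt(2,3) by (simp add: \<psi>)
    qed
    show "ht (\<psi> x) = ht (\<psi> y)" if xy: "x \<in> \<phi> ` D" "y \<in> \<phi> ` D" "g x = g y" for x y
    proof -
      obtain q q' where "q \<in> D" "x = \<phi> q" "q' \<in> D" "y = \<phi> q'" using xy(1,2) by blast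
      then show ?thesis using lab_ht[of q q'] xy(3) by (simp add: \<psi> g_def)
    qed
    show "finite (g ` \<phi> ` D)" by (rule fin)
    show "\<exists>M. window X M {x \<in> \<phi> ` D. g x = l}" if "l \<in> g ` \<phi> ` D" for l using that by (rule fib)
  qed (rule that)
  \<comment> \<open>Coordinates within \<open>m\<close> of 0 on level \<open>j\<close> become
    coordinates between \<open>- j - m\<close> and \<open>m - j\<close> at the base. As
    \<open>j\<close> is less than the height, \<open>lab_agree\<close> controls all of them.\<close>
  have "agree m x y" if Q: "Q \<in> atoms XT shift (card (g ` \<phi> ` D)) B h" and xyQ: "x \<in> Q" "y \<in> Q" for Q x y
  proof -
    obtain k j where kj: "k \<in> {1..card (g ` \<phi> ` D)}" "j < h k" "Q = {x \<in> X. sh (int j) x \<in> B k}"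
      using Q by (auto simp: atoms_def levels_def preim_eq)
    then have xy: "sh (int j) x \<in> B k" "sh (int j) y \<in> B k" using xyQ by auto
    obtain q q' where q: "q \<in> D" "sh (int j) x = \<phi> q" "q' \<in> D" "sh (int j) y = \<phi> q'"
      using P(4)[OF kj(1) xy(1)] P(4)[OF kj(1) xy(2)] by auto
    have "lab q = lab q'" using P(5)[OF kj(1) xy] q by (simp add: g_def \<psi>)
    moreover have hk: "ht q = h k" using P(4)[OF kj(1) xy(1)] q by (simp add: \<psi>)
    ultimately have eq: "\<phi> q i = \<phi> q' i" if "- int (h k) - int m \<le> i" "i \<le> int m" for i
      using lab_agree[of q q'] q that by simp
    have "x i = y i" if "\<bar>i\<bar> \<le> int m" for i
    proof -
      have "sh (int j) x (i - int j) = sh (int j) y (i - int j)"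
        unfolding q using that kj(2) by (intro eq) auto
      then show ?thesis by (simp add: sh_apply)
    qed
    then show ?thesis by (simp add: agree_def)
  qed
  moreover have "n \<le> h k" if k: "k \<in> {1..card (g ` \<phi> ` D)}" for k
  proof -
    obtain x where "x \<in> B k" using P(3)[OF k] by blast
    then have "x \<in> \<phi> ` D" "h k = ht (\<psi> x)" using P(4)[OF k] by auto
    then show ?thesis using ret(1) \<psi> by fastforce
  qed
  moreover have "\<phi> ` D \<subseteq> U" using \<phi>_U by blast
  ultimately show ?thesis
    using card P(1,2) D(1) by (intro exI[of _ "card (g ` \<phi> ` D)"] exI[of _ B] exI[of _ h]) auto
qed

end

section \<open>From recognizable words to nested partitions\<close>

lemma finite_levels: "finite (levels d h)"
proof -
  have "levels d h = Sigma {1..d} (\<lambda>k. {..<h k})" by (auto simp: levels_def)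
  then show ?thesis by simp
qed

context infinite_minimal
begin

lemma CKR_baseD:
  assumes "CKR_partition XT shift d B h" "k \<in> {1..d}"
  shows "openin XT (B k)" "closedin XT (B k)" "1 \<le> h k" "B k \<subseteq> X"
proof -
  show "openin XT (B k)" "closedin XT (B k)" "1 \<le> h k"
    using assms unfolding CKR_partition_def by blast+
  then show "B k \<subseteq> X" using openin_subset by force
qed

lemma CKR_base_clopen:
  assumes "CKR_partition XT shift d B h"
  shows "openin XT (base d B)" "closedin XT (base d B)"
  unfolding base_def using CKR_baseD[OF assms] by (auto intro!: openin_Union closedin_Union)

lemma CKR_atom_clopen:
  assumes "CKR_partition XT shift d B h" "Q \<in> atoms XT shift d B h"
  shows "openin XT Q" "closedin XT Q"
proof -
  obtain k j where Q: "k \<in> {1..d}" "Q = {x \<in> X. sh (int j) x \<in> B k}"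
    using assms(2) by (auto simp: atoms_def levels_def preim_eq)
  obtain m where "window X m (B k)" using CKR_baseD[OF assms(1) Q(1)] clopen_imp_window by blast
  then have "window X (m + nat \<bar>int j\<bar>) Q" unfolding Q(2) by (rule window_preimage)
  then show "openin XT Q" "closedin XT Q" by (simp_all add: window_imp_clopen)
qed

lemma common_window:
  assumes "finite S" "\<And>V. V \<in> S \<Longrightarrow> openin XT V \<and> closedin XT V"
  shows "\<exists>m. \<forall>V\<in>S. window X m V"
  using assms
proof (induction S rule: finite_induct)
  case (insert V S)
  then obtain m m' where m: "\<forall>V\<in>S. window X m V" "window X m' V"
    using clopen_imp_window by (metis insertCI)
  have "window X (m + m') V'" if "V' \<in> insert V S" for V'
    using m that by (auto intro: window_mono)
  then show ?case by blast
qed simp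

lemma CKR_window:
  assumes "CKR_partition XT shift d B h"
  shows "\<exists>m. window X m (base d B) \<and> (\<forall>Q\<in>atoms XT shift d B h. window X m Q)"
proof -
  have "finite (insert (base d B) (atoms XT shift d B h))"
    by (simp add: atoms_def finite_levels)
  then have "\<exists>m. \<forall>V\<in>insert (base d B) (atoms XT shift d B h). window X m V"
    by (rule common_window) (use CKR_base_clopen[OF assms] CKR_atom_clopen[OF assms] in blast)
  then show ?thesis by blast
qed

lemma CKR_partition_on: "CKR_partition XT shift d B h \<Longrightarrow> partition_on X (atoms XT shift d B h)"
  unfolding CKR_partition_def topspace_XT by blast

lemma CKR_trivial: "CKR_partition XT shift 1 (\<lambda>_. X) (\<lambda>_. 1)" "atoms XT shift 1 (\<lambda>_. X) (\<lambda>_. 1) = {X}"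
proof -
  have l: "levels 1 (\<lambda>_. 1) = {(1, 0)}" by (auto simp: levels_def)
  have p: "preim XT shift j X = X" for j unfolding preim_eq by simp
  show a: "atoms XT shift 1 (\<lambda>_. X) (\<lambda>_. 1) = {X}" unfolding atoms_def l by (simp add: p)
  have "X \<noteq> {}" using infinite_X by auto
  then show "CKR_partition XT shift 1 (\<lambda>_. X) (\<lambda>_. 1)"
    unfolding CKR_partition_def a unfolding l base_def p disjoint_family_on_def
    using openin_topspace[of XT] closedin_topspace[of XT] unfolding topspace_XT
    by (auto simp: partition_on_def)
qed

lemma topology_generated_by_refining:
  assumes "\<And>P. P \<in> S \<Longrightarrow> openin XT P"
    and "\<And>x m. x \<in> X \<Longrightarrow> \<exists>P\<in>S. x \<in> P \<and> (\<forall>y\<in>P. agree m x y)"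
  shows "topology_generated_by S = XT"
  unfolding topology_eq openin_topology_generated_by_iff
proof (intro allI iffI)
  fix V assume "generate_topology_on S V"
  then show "openin XT V" by (induction rule: generate_topology_on.induct) (auto intro: assms(1))
next
  fix V assume V: "openin XT V"
  have "x \<in> \<Union> {P \<in> S. P \<subseteq> V}" if x: "x \<in> V" for x
  proof -
    obtain m where m: "\<forall>y\<in>X. agree m x y \<longrightarrow> y \<in> V" and "x \<in> X"
      using V x unfolding openin_window_iff[OF X_sub] by blast
    then obtain P where P: "P \<in> S" "x \<in> P" "\<forall>y\<in>P. agree m x y" using assms(2) by blast
    moreover have "P \<subseteq> X" using openin_subset[OF assms(1)[OF P(1)]] by simp
    ultimately have "P \<subseteq> V" using m by blast
    then show ?thesis using P by blast
  qed
  then have "V = \<Union> {P \<in> S. P \<subseteq> V}" by blast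
  moreover have "generate_topology_on S (\<Union> {P \<in> S. P \<subseteq> V})"
    by (intro generate_topology_on.UN) (auto intro: generate_topology_on.Basis)
  ultimately show "generate_topology_on S V" by simp
qed

text \<open>\<open>U\<close> is a cylinder of radius \<open>m\<close> inside the old base, where
  \<open>m\<close> exceeds by \<open>n\<close> a window common to the old base and all old atoms.
  Moving the new base into \<open>U\<close> gives nesting and brings its points together. New atoms
  whose points agree up to \<open>m\<close> cannot meet two old atoms, so the partition is
  refined.\<close>

lemma CKR_refine_step:
  assumes returns: "\<And>N. long_returns r N"
    and P: "CKR_partition XT shift d B h" "base d B \<noteq> {}"
  shows "\<exists>d' B' h'. d' \<le> r ^ 3 \<and> CKR_partition XT shift d' B' h' \<and> base d' B' \<noteq> {} \<and>
      base d' B' \<subseteq> base d B \<and> (\<forall>P\<in>atoms XT shift d' B' h'. \<exists>Q\<in>atoms XT shift d B h. P \<subseteq> Q) \<and>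
      (\<forall>k\<in>{1..d'}. n \<le> h' k) \<and> (\<forall>x\<in>base d' B'. \<forall>y\<in>base d' B'. agree n x y) \<and>
      (\<forall>P\<in>atoms XT shift d' B' h'. \<forall>x\<in>P. \<forall>y\<in>P. agree n x y)"
proof -
  obtain m0 where m0: "window X m0 (base d B)" "\<And>Q. Q \<in> atoms XT shift d B h \<Longrightarrow> window X m0 Q"
    using CKR_window[OF P(1)] by blast
  define m where "m = m0 + n"
  have m: "window X m (base d B)" "\<And>Q. Q \<in> atoms XT shift d B h \<Longrightarrow> window X m Q"
    unfolding m_def using m0 by (auto intro: window_mono[of X m0])
  obtain x0 where x0: "x0 \<in> base d B" using P(2) by blast
  then have x0X: "x0 \<in> X" using m(1) by (auto simp: window_def)
  define U where "U = {y \<in> X. agree m x0 y}"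
  have U: "window X m U" "U \<noteq> {}" "U \<subseteq> base d B"
  proof -
    show "window X m U" unfolding window_def U_def by (auto intro: agree_trans)
    show "U \<noteq> {}" using x0X by (auto simp: U_def)
    show "U \<subseteq> base d B" using windowD[OF m(1) x0X] x0 by (auto simp: U_def)
  qed
  obtain d' B' h' where *: "d' \<le> r ^ 3" "CKR_partition XT shift d' B' h'" "base d' B' \<subseteq> U" "base d' B' \<noteq> {}"
      "\<forall>k\<in>{1..d'}. n \<le> h' k" and at: "\<forall>P\<in>atoms XT shift d' B' h'. \<forall>x\<in>P. \<forall>y\<in>P. agree m x y"
    using refining_partition[OF returns U(1,2), of n] by blast
  have "\<exists>Q\<in>atoms XT shift d B h. P' \<subseteq> Q" if P': "P' \<in> atoms XT shift d' B' h'" for P'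
  proof -
    have part: "partition_on X (atoms XT shift d' B' h')" using *(2) by (rule CKR_partition_on)
    then obtain x where x: "x \<in> P'" using P' by (fastforce simp: partition_on_def)
    have P'X: "P' \<subseteq> X" using part P' by (auto simp: partition_on_def)
    then obtain Q where Q: "Q \<in> atoms XT shift d B h" "x \<in> Q"
      using x CKR_partition_on[OF P(1)] by (auto simp: partition_on_def)
    have "y \<in> Q" if y: "y \<in> P'" for y
    proof -
      have "agree m x y" using at P' x y by blast
      then show ?thesis using windowD[OF m(2)[OF Q(1)], of x y] x y P'X Q(2) by blast
    qed
    then show ?thesis using Q by blast
  qed
  moreover have "agree n x y" if "x \<in> base d' B'" "y \<in> base d' B'" for x y
  proof -
    have "agree m x0 x" "agree m x0 y" using that *(3) by (auto simp: U_def)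
    then have "agree m x y" using agree_sym agree_trans by blast
    then show ?thesis by (rule agree_mono) (simp add: m_def)
  qed
  moreover have "\<forall>P\<in>atoms XT shift d' B' h'. \<forall>x\<in>P. \<forall>y\<in>P. agree n x y"
  proof (intro ballI)
    fix P x y assume "P \<in> atoms XT shift d' B' h'" "x \<in> P" "y \<in> P"
    then have "agree m x y" using at by blast
    then show "agree n x y" by (rule agree_mono) (simp add: m_def)
  qed
  moreover have "base d' B' \<subseteq> base d B" using *(3) U(3) by (rule order_trans)
  ultimately show ?thesis
    using * by (intro exI[of _ d'] exI[of _ B'] exI[of _ h'] conjI) simp_all
qed

text \<open>By minimality, a bounded time suffices to reach the farthest level of any tower of level
  \<open>n\<close>, and from there the tower is run through completely. Every tower taller than this
  time plus the height crosses it.\<close>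

lemma primitive_of_heights:
  assumes P: "\<And>n. CKR_partition XT shift (d n) (B n) (h n)"
    and hN: "\<And>n k. k \<in> {1..d (Suc n)} \<Longrightarrow> n \<le> h (Suc n) k"
  shows "primitive_CKR XT shift d B h"
  unfolding primitive_CKR_def
proof (intro allI impI)
  fix n :: nat
  define V where "V l = {x \<in> X. sh (int (h n l - 1)) x \<in> B n l}" for l
  have "\<exists>G. \<forall>x\<in>X. \<exists>i\<le>G. sh (int i) x \<in> V l" if l: "l \<in> {1..d n}" for l
  proof (rule visits)
    have "1 \<le> h n l" using CKR_baseD[OF P l] by simp
    then have "(l, h n l - 1) \<in> levels (d n) (h n)" using l by (simp add: levels_def)
    then have V: "V l \<in> atoms XT shift (d n) (B n) (h n)"
      unfolding atoms_def V_def preim_eq[symmetric] by force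
    then show "openin XT (V l)" by (rule CKR_atom_clopen[OF P])
    show "V l \<noteq> {}" using V CKR_partition_on[OF P] by (auto simp: partition_on_def)
  qed
  then obtain G where G: "\<And>l x. l \<in> {1..d n} \<Longrightarrow> x \<in> X \<Longrightarrow> \<exists>i\<le>G l. sh (int i) x \<in> V l"
    by metis
  define M where "M = (\<Sum>l\<in>{1..d n}. G l + h n l)"
  have M: "G l + h n l \<le> M" if "l \<in> {1..d n}" for l
    unfolding M_def using that by (intro member_le_sum[of l _ "\<lambda>l. G l + h n l"]) auto
  \<comment> \<open>The heights at level \<open>Suc (n + M)\<close> are at least
    \<open>n + M\<close>, and \<open>M\<close> dominates each waiting time plus height by being
    their sum over all towers.\<close>
  show "\<exists>N>n. \<forall>k\<in>{1..d N}. \<forall>l\<in>{1..d n}. tower_crosses XT shift (B N k) (h N k) (B n l) (h n l)"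
  proof (intro exI[of _ "Suc (n + M)"] conjI ballI)
    fix k l assume k: "k \<in> {1..d (Suc (n + M))}" and l: "l \<in> {1..d n}"
    show "tower_crosses XT shift (B (Suc (n + M)) k) (h (Suc (n + M)) k) (B n l) (h n l)"
      unfolding tower_crosses_def
    proof
      fix x assume "x \<in> preim XT shift (h (Suc (n + M)) k - 1) (B (Suc (n + M)) k)"
      then have x: "x \<in> X" by (simp add: preim_eq)
      obtain i where i: "i \<le> G l" "sh (int i) x \<in> V l" using G[OF l x] by blast
      have "i + h n l \<le> h (Suc (n + M)) k" using i(1) M[OF l] hN[OF k] by linarith
      moreover have "(shift ^^ (i + j)) x \<in> preim XT shift (h n l - 1 - j) (B n l)" if j: "j < h n l" for j
      proof -
        have "int (h n l - 1 - j) + int (i + j) = int (h n l - 1) + int i" using j by simp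
        then have "sh (int (h n l - 1 - j)) (sh (int (i + j)) x) = sh (int (h n l - 1)) (sh (int i) x)"
          unfolding sh_sh by (rule arg_cong[where f = "\<lambda>k. sh k x"])
        then show ?thesis using i(2) x unfolding preim_eq V_def shift_funpow by simp
      qed
      ultimately show "\<exists>i. i + h n l \<le> h (Suc (n + M)) k \<and>
          (\<forall>j<h n l. (shift ^^ (i + j)) x \<in> preim XT shift (h n l - 1 - j) (B n l))" by blast
    qed
  qed simp
qed

text \<open>Every step draws a fresh base with return words long enough for the partition already
  reached, so the bound \<open>r ^ 3\<close> holds at each level and does not accumulate. The 1 in
  the maximum is the single tower of the trivial partition at level 0.\<close>

lemma rank_of_returns:
  assumes returns: "\<And>N. long_returns r N"
  shows "topological_rank_le XT shift (max 1 (r ^ 3))"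
proof -
  define good where "good n s \<longleftrightarrow> (case s of (d, B, h) \<Rightarrow>
      d \<le> max 1 (r ^ 3) \<and> CKR_partition XT shift d B h \<and> base d B \<noteq> {} \<and>
      (n = 0 \<longrightarrow> atoms XT shift d B h = {X}))" for n :: nat and s
  define step where "step n s s' \<longleftrightarrow> (case s of (d, B, h) \<Rightarrow> case s' of (d', B', h') \<Rightarrow>
      base d' B' \<subseteq> base d B \<and> (\<forall>P\<in>atoms XT shift d' B' h'. \<exists>Q\<in>atoms XT shift d B h. P \<subseteq> Q) \<and>
      (\<forall>k\<in>{1..d'}. n \<le> h' k) \<and> (\<forall>x\<in>base d' B'. \<forall>y\<in>base d' B'. agree n x y) \<and>
      (\<forall>P\<in>atoms XT shift d' B' h'. \<forall>x\<in>P. \<forall>y\<in>P. agree n x y))" for n s s'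
  have "\<exists>s. \<forall>n. good n (s n) \<and> step n (s n) (s (Suc n))"
  proof (rule dependent_nat_choice)
    have "good 0 (1, (\<lambda>_. X), (\<lambda>_. 1))"
      using CKR_trivial infinite_X by (auto simp: good_def base_def)
    then show "\<exists>s. good 0 s" by blast
  next
    fix s n assume "good n s"
    then obtain d B h where s: "s = (d, B, h)" "CKR_partition XT shift d B h" "base d B \<noteq> {}"
      by (cases s) (auto simp: good_def)
    have "\<exists>d' B' h'. d' \<le> r ^ 3 \<and> CKR_partition XT shift d' B' h' \<and> base d' B' \<noteq> {} \<and> step n s (d', B', h')"
      unfolding step_def s(1) prod.case by (rule CKR_refine_step[OF returns s(2,3)])
    then obtain d' B' h' where "d' \<le> r ^ 3" "CKR_partition XT shift d' B' h'" "base d' B' \<noteq> {}"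
      and st: "step n s (d', B', h')" by (elim exE conjE)
    then have "good (Suc n) (d', B', h')" by (simp add: good_def)
    then show "\<exists>s'. good (Suc n) s' \<and> step n s s'" using st by blast
  qed
  then obtain s where s: "\<And>n. good n (s n)" "\<And>n. step n (s n) (s (Suc n))" by blast
  define d B h where "d n = fst (s n)" and "B n = fst (snd (s n))" and "h n = snd (snd (s n))" for n
  have P: "d n \<le> max 1 (r ^ 3)" "CKR_partition XT shift (d n) (B n) (h n)" "base (d n) (B n) \<noteq> {}" for n
    using s(1)[of n] by (auto simp: good_def d_def B_def h_def split: prod.splits)
  have at0: "atoms XT shift (d 0) (B 0) (h 0) = {X}"
    using s(1)[of 0] by (auto simp: good_def d_def B_def h_def split: prod.splits)
  have st: "base (d (Suc n)) (B (Suc n)) \<subseteq> base (d n) (B n)"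
      "\<forall>P\<in>atoms XT shift (d (Suc n)) (B (Suc n)) (h (Suc n)). \<exists>Q\<in>atoms XT shift (d n) (B n) (h n). P \<subseteq> Q"
      "\<forall>k\<in>{1..d (Suc n)}. n \<le> h (Suc n) k"
      "\<forall>x\<in>base (d (Suc n)) (B (Suc n)). \<forall>y\<in>base (d (Suc n)) (B (Suc n)). agree n x y"
      "\<forall>P\<in>atoms XT shift (d (Suc n)) (B (Suc n)) (h (Suc n)). \<forall>x\<in>P. \<forall>y\<in>P. agree n x y" for n
    using s(2)[of n] unfolding step_def d_def B_def h_def case_prod_beta by metis+
  have "\<exists>x. (\<Inter>n. base (d n) (B n)) = {x}"
  proof -
    have "(\<Inter>n. base (d n) (B n)) \<noteq> {}"
    proof
      assume "(\<Inter>n. base (d n) (B n)) = {}"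
      then have "\<exists>n. base (d n) (B n) = {}"
        by (rule nest[rotated 2]) (use st(1) CKR_base_clopen(2)[OF P(2)] in auto)
      then show False using P(3) by blast
    qed
    then obtain x where x: "x \<in> (\<Inter>n. base (d n) (B n))" by blast
    have "y = x" if y: "y \<in> (\<Inter>n. base (d n) (B n))" for y
    proof (rule agree_all_imp_eq)
      fix n
      have "x \<in> base (d (Suc n)) (B (Suc n))" "y \<in> base (d (Suc n)) (B (Suc n))" using x y by blast+
      then show "agree n y x" using st(4)[of n] by blast
    qed
    then show ?thesis using x by blast
  qed
  moreover have "topology_generated_by (\<Union>n. atoms XT shift (d n) (B n) (h n)) = XT"
  proof (rule topology_generated_by_refining)
    fix Q assume "Q \<in> (\<Union>n. atoms XT shift (d n) (B n) (h n))"
    then show "openin XT Q" using CKR_atom_clopen[OF P(2)] by blast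
  next
    fix x m assume "x \<in> X"
    then obtain Q where "Q \<in> atoms XT shift (d (Suc m)) (B (Suc m)) (h (Suc m))" "x \<in> Q"
      using CKR_partition_on[OF P(2), of "Suc m"] by (auto simp: partition_on_def)
    then show "\<exists>P\<in>\<Union>n. atoms XT shift (d n) (B n) (h n). x \<in> P \<and> (\<forall>y\<in>P. agree m x y)"
      using st(5)[of m] by blast
  qed
  ultimately have "nested_CKR XT shift d B h"
    unfolding nested_CKR_def topspace_XT using P(2) at0 st(1,2) by simp
  moreover have "primitive_CKR XT shift d B h"
    using P(2) st(3) by (intro primitive_of_heights) auto
  ultimately show ?thesis unfolding topological_rank_le_def using P(1) by blast
qed

text \<open>As \<open>K_inf\<close> increases with the length bound, its limit bounds every term.
  The infimum runs over natural numbers, so a bound \<open>r\<close> on it yields an actual set of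
  at most \<open>r\<close> words: otherwise \<open>Suc r\<close> would be a lower bound.\<close>

lemma finite_K_imp_finite_rank:
  assumes "K A X < \<infinity>"
  shows "finite_topological_rank XT shift"
proof -
  obtain r where r: "K A X = enat r" using assms by (cases "K A X") auto
  have "K_inf A X m \<le> K_inf A X n" if "m \<le> n" for m n
    unfolding K_inf_def
    by (intro INF_superset_mono) (use that in \<open>auto intro: order_trans\<close>)
  then have "incseq (K_inf A X)" by (simp add: incseq_def)
  then have K_inf: "K_inf A X N \<le> enat r" for N
    using incseq_le[OF _ K_inf_LIMSEQ] r by metis
  have "topological_rank_le XT shift (max 1 (r ^ 3))"
  proof (rule rank_of_returns)
    fix N
    have "\<exists>W. W \<subseteq> (\<Union>k\<in>{N..}. words k X) \<and> finite W \<and> recognizable_words A X W \<and> card W \<le> r"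
    proof (rule ccontr)
      assume "\<not> ?thesis"
      then have "enat (Suc r) \<le> K_inf A X N"
        unfolding K_inf_def by (intro INF_greatest) (auto simp: not_less_eq_eq)
      then have "enat (Suc r) \<le> enat r" using K_inf order_trans by blast
      then show False by simp
    qed
    then obtain W where W: "W \<subseteq> (\<Union>k\<in>{N..}. words k X)" "finite W" "recognizable_words A X W" "card W \<le> r"
      by blast
    obtain M D where D: "D \<noteq> {}" "window X M D"
      "\<And>x. x \<in> D \<Longrightarrow> \<exists>h\<ge>1. sh (- int h) x \<in> D \<and>
         (\<forall>t. 0 < t \<and> t < h \<longrightarrow> sh (- int t) x \<notin> D) \<and> factor x (1 - int h) h \<in> W"
      using recognizable_words_imp_returns[OF W(3)] by metis
    have "N \<le> length w" if "w \<in> W" for w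
      using W(1) that by (auto simp: words_def factor_def)
    then show "long_returns r N"
      unfolding long_returns_def
      using W(2,4) D by (intro exI[of _ W] exI[of _ M] exI[of _ D]) blast
  qed
  then show ?thesis unfolding finite_topological_rank_def by blast
qed

end

section \<open>From nested partitions to recognizable words\<close>

text \<open>Positive indices follow chosen preimages, negative ones iterate \<open>p\<close>. With
  \<open>p\<close> the previous visit to the base, this produces the two-sided sequence of visits
  and hence the sequence of towers that an orbit runs through.\<close>

lemma int_orbit:
  assumes "S \<noteq> {}" "\<And>z. z \<in> S \<Longrightarrow> p z \<in> S" "\<And>z. z \<in> S \<Longrightarrow> \<exists>w\<in>S. p w = z"
  shows "\<exists>q :: int \<Rightarrow> 'a. \<forall>i. q i \<in> S \<and> q i = p (q (i + 1))"
proof -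
  obtain nx where nx: "\<And>z. z \<in> S \<Longrightarrow> nx z \<in> S \<and> p (nx z) = z" using assms(3) by metis
  obtain z where z: "z \<in> S" using assms(1) by blast
  define q where "q i = (if 0 \<le> i then (nx ^^ nat i) z else (p ^^ nat (- i)) z)" for i
  have n: "(nx ^^ n) z \<in> S" for n by (induction n) (use z nx in simp_all)
  have m: "(p ^^ n) z \<in> S" for n by (induction n) (use z assms(2) in auto)
  have "q i = p (q (i + 1))" for i
  proof (cases "0 \<le> i")
    case True
    then have "nat (i + 1) = Suc (nat i)" by simp
    then show ?thesis using True nx[OF n[of "nat i"]] by (simp add: q_def)
  next
    case False
    then have "nat (- i) = Suc (nat (- (i + 1)))" by simp
    then have "q i = p ((p ^^ nat (- (i + 1))) z)" using False by (simp add: q_def)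
    also have "\<dots> = p (q (i + 1))" using False by (cases "i = -1") (simp_all add: q_def)
    finally show ?thesis .
  qed
  moreover have "q i \<in> S" for i using n m by (simp add: q_def)
  ultimately show ?thesis by blast
qed

context infinite_minimal
begin

lemma CKR_level_unique:
  assumes "CKR_partition XT shift d B h" "x \<in> X"
    and "k \<in> {1..d}" "j < h k" "sh (int j) x \<in> B k"
    and "k' \<in> {1..d}" "j' < h k'" "sh (int j') x \<in> B k'"
  shows "k = k' \<and> j = j'"
proof (rule ccontr)
  assume ne: "\<not> ?thesis"
  have "disjoint_family_on (\<lambda>(k, j). preim XT shift j (B k)) (levels d h)"
    using assms(1) by (simp add: CKR_partition_def)
  then have "(case (k, j) of (k, j) \<Rightarrow> preim XT shift j (B k)) \<inter>
      (case (k', j') of (k, j) \<Rightarrow> preim XT shift j (B k)) = {}"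
    using ne assms by (intro disjoint_family_onD) (auto simp: levels_def)
  then show False using assms by (auto simp: preim_eq)
qed

text \<open>The letters are the towers, and \<open>\<tau> k\<close> is the word read while climbing
  tower \<open>k\<close> from its farthest level to its base; this is well defined because atoms
  determine coordinate 0. Different towers may spell the same word, hence only an inequality for
  \<open>card W\<close>. Recognizability does not suffer, since \<open>Y\<close> also records which
  tower is visited.\<close>

lemma CKR_imp_recognizable_words:
  assumes P: "CKR_partition XT shift d B h"
    and const: "\<And>Q x y. Q \<in> atoms XT shift d B h \<Longrightarrow> x \<in> Q \<Longrightarrow> y \<in> Q \<Longrightarrow> x 0 = y 0"
  shows "\<exists>W. finite W \<and> card W \<le> d \<and> recognizable_words A X W \<and> W \<subseteq> (\<Union>k\<in>{1..d}. words (h k) X)"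
proof -
  note BD = CKR_baseD[OF P]
  define bottom where "bottom k x \<longleftrightarrow> x \<in> X \<and> sh (int (h k - 1)) x \<in> B k" for k x
  define \<tau> where "\<tau> k = factor (SOME x. bottom k x) 0 (h k)" for k
  have bottom_ex: "\<exists>x. bottom k x" if k: "k \<in> {1..d}" for k
  proof -
    have "(k, h k - 1) \<in> levels d h" using BD(3)[OF k] k by (simp add: levels_def)
    then have "preim XT shift (h k - 1) (B k) \<in> atoms XT shift d B h" by (force simp: atoms_def)
    then have "preim XT shift (h k - 1) (B k) \<noteq> {}"
      using CKR_partition_on[OF P] by (auto simp: partition_on_def)
    then show ?thesis by (auto simp: bottom_def preim_eq)
  qed
  have bottom_eq: "x (int i) = y (int i)"
    if k: "k \<in> {1..d}" and xy: "bottom k x" "bottom k y" and i: "i < h k" for k x y i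
  proof -
    have "(k, h k - 1 - i) \<in> levels d h" using k i by (simp add: levels_def)
    then have "preim XT shift (h k - 1 - i) (B k) \<in> atoms XT shift d B h" by (force simp: atoms_def)
    moreover have "int (h k - 1 - i) + int i = int (h k - 1)" using i by simp
    then have "sh (int i) z \<in> preim XT shift (h k - 1 - i) (B k)" if "bottom k z" for z
      using that by (simp add: preim_eq bottom_def)
    ultimately have "sh (int i) x 0 = sh (int i) y 0" using const xy by blast
    then show ?thesis by (simp add: sh_apply)
  qed
  have \<tau>: "factor x 0 (h k) = \<tau> k" if k: "k \<in> {1..d}" and x: "bottom k x" for k x
  proof -
    have "bottom k (SOME x. bottom k x)" using bottom_ex[OF k] by (rule someI_ex)
    then show ?thesis unfolding \<tau>_def factor_def using bottom_eq[OF k x] by (intro map_cong) auto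
  qed
  have len: "length (\<tau> k) = h k" for k by (simp add: \<tau>_def factor_def)
  have \<tau>_ne: "\<tau> k \<noteq> []" if "k \<in> {1..d}" for k using len[of k] BD(3)[OF that] by auto
  define E where "E = morphism_ext \<tau>"
  \<comment> \<open>\<open>Y\<close> is cut out by conditions on finite windows instead of being
    defined as the set of tower sequences of points of \<open>X\<close>. This makes closedness
    immediate up to continuity; that \<open>Y\<close> is nonempty is shown later from an actual
    orbit.\<close>
  define Y where "Y = {y. (\<forall>i. y i \<in> {1..d}) \<and> E y \<in> X \<and> (\<forall>i. sh (cut \<tau> y (i + 1) - 1) (E y) \<in> B (y i))}"
  have YD: "y i \<in> {1..d}" "E y \<in> X" "sh (cut \<tau> y (i + 1) - 1) (E y) \<in> B (y i)" "\<tau> (y i) \<noteq> []"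
    if "y \<in> Y" for y i using that \<tau>_ne unfolding Y_def by blast+
  have Y_cell: "sh (int (h (y i) - 1)) (sh (cut \<tau> y i) (E y)) \<in> B (y i)" if y: "y \<in> Y" for y i
  proof -
    have "int (h (y i) - 1) + cut \<tau> y i = cut \<tau> y (i + 1) - 1"
      using BD(3)[OF YD(1)[OF y]] by (simp add: cut_step len of_nat_diff)
    then show ?thesis using YD(3)[OF y, of i] by simp
  qed
  have Y_sh: "sh n y \<in> Y" if y: "y \<in> Y" for y n
  proof -
    have E: "E (sh n y) = sh (cut \<tau> y n) (E y)"
      unfolding E_def using YD(4)[OF y] by (rule morphism_ext_sh)
    have "sh (cut \<tau> (sh n y) (i + 1) - 1) (E (sh n y)) \<in> B (sh n y i)" for i
    proof -
      have "cut \<tau> (sh n y) (i + 1) = cut \<tau> y (i + 1 + n) - cut \<tau> y n"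
        using YD(4)[OF y] by (rule cut_sh)
      then show ?thesis using YD(3)[OF y, of "i + n"] unfolding E sh_sh sh_apply
        by (simp add: algebra_simps)
    qed
    moreover have "\<forall>i. sh n y i \<in> {1..d}" unfolding sh_apply using YD(1)[OF y] by blast
    moreover have "E (sh n y) \<in> X" using YD(2)[OF y] by (simp add: E)
    ultimately show ?thesis unfolding Y_def by blast
  qed
  have "subshift {1..d} Y"
    unfolding subshift_closed
  proof (intro conjI ballI allI impI)
    fix y i assume "y \<in> Y" then show "y i \<in> {1..d}" by (rule YD)
  next
    fix y assume ap: "\<forall>m. \<exists>z\<in>Y. agree m y z"
    have yL: "y i \<in> {1..d}" for i
    proof -
      obtain z where "z \<in> Y" "agree (nat \<bar>i\<bar>) y z" using ap by blast
      then show ?thesis using YD(1)[of z i] by (simp add: agree_def)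
    qed
    have EX: "E y \<in> X"
    proof (rule X_closed)
      fix m
      obtain z where z: "z \<in> Y" "agree m y z" using ap by blast
      then have "agree m (E y) (E z)"
        unfolding E_def using \<tau>_ne[OF yL] YD(4) by (intro agree_morphism_ext) auto
      then show "\<exists>x\<in>X. agree m (E y) x" using YD(2)[OF z(1)] by blast
    qed
    have "sh (cut \<tau> y (i + 1) - 1) (E y) \<in> B (y i)" for i
    proof -
      define c where "c = cut \<tau> y (i + 1) - 1"
      obtain M where M: "window X M (B (y i))" using BD[OF yL] clopen_imp_window by blast
      \<comment> \<open>The radius covers letter \<open>i\<close>, the letters that determine the
        cut after it, and the window of \<open>B (y i)\<close> once moved by
        \<open>c\<close>.\<close>
      obtain z where z: "z \<in> Y" "agree (M + nat \<bar>c\<bar> + nat \<bar>i + 1\<bar> + nat \<bar>i\<bar>) y z" using ap by blast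
      then have "agree (M + nat \<bar>c\<bar> + nat \<bar>i + 1\<bar> + nat \<bar>i\<bar>) (E y) (E z)"
        unfolding E_def using \<tau>_ne[OF yL] YD(4) by (intro agree_morphism_ext) auto
      then have "agree (M + nat \<bar>c\<bar>) (E y) (E z)" by (rule agree_mono) simp
      then have "agree M (sh c (E y)) (sh c (E z))" by (rule agree_sh)
      then have "sh c (E y) \<in> B (y i) \<longleftrightarrow> sh c (E z) \<in> B (y i)"
        using EX YD(2)[OF z(1)] by (intro windowD[OF M]) simp_all
      moreover have "y i = z i" using z(2) by (simp add: agree_def)
      moreover have "cut \<tau> y (i + 1) = cut \<tau> z (i + 1)"
        using z(2) by (intro cut_cong) (simp add: agree_def)
      ultimately show ?thesis using YD(3)[OF z(1), of i] by (simp add: c_def)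
    qed
    then show "y \<in> Y" using yL EX unfolding Y_def by blast
  next
    show "shift ` Y = Y"
    proof
      show "shift ` Y \<subseteq> Y" unfolding shift_eq_sh using Y_sh by blast
      show "Y \<subseteq> shift ` Y"
      proof
        fix y assume "y \<in> Y"
        then have "sh (-1) y \<in> Y" "y = sh 1 (sh (-1) y)" using Y_sh by simp_all
        then show "y \<in> shift ` Y" unfolding shift_eq_sh by blast
      qed
    qed
  qed simp
  moreover have "recognizable_morphism A \<tau> Y"
    unfolding recognizable_morphism_def
  proof (intro ballI allI impI)
    fix x k k' y y'
    assume y: "y \<in> Y" "y' \<in> Y" and *: "k < length (\<tau> (y 0)) \<and> x = (shift ^^ k) (morphism_ext \<tau> y) \<and>
        k' < length (\<tau> (y' 0)) \<and> x = (shift ^^ k') (morphism_ext \<tau> y')"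
    then have k: "k < h (y 0)" "k' < h (y' 0)" and x: "x = sh (int k) (E y)" "x = sh (int k') (E y')"
      by (auto simp: len shift_funpow E_def)
    have xX: "x \<in> X" using x YD(2)[OF y(1)] by simp
    have top: "sh (int (h (z 0) - 1 - i)) (sh (int i) (E z)) \<in> B (z 0)" if "z \<in> Y" "i < h (z 0)" for z i
    proof -
      have "int (h (z 0) - 1 - i) + int i = int (h (z 0) - 1)" using that(2) by simp
      then show ?thesis using Y_cell[OF that(1), of 0] by (simp add: cut_0)
    qed
    \<comment> \<open>Offset \<open>k\<close> counts from the farthest level, the level index from
      the base: hence the level \<open>h (y 0) - 1 - k\<close>.\<close>
    have "y 0 = y' 0 \<and> h (y 0) - 1 - k = h (y' 0) - 1 - k'"
    proof (rule CKR_level_unique[OF P xX])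
      show "sh (int (h (y 0) - 1 - k)) x \<in> B (y 0)" using top[OF y(1) k(1)] unfolding x(1) .
      show "sh (int (h (y' 0) - 1 - k')) x \<in> B (y' 0)" using top[OF y(2) k(2)] unfolding x(2) .
      show "y 0 \<in> {1..d}" "y' 0 \<in> {1..d}" using YD(1) y by blast+
      show "h (y 0) - 1 - k < h (y 0)" "h (y' 0) - 1 - k' < h (y' 0)" using k by simp_all
    qed
    then have kk: "k = k'" using k by auto
    then have EE: "E y = E y'" using x by simp
    have same: "y i = y' i" if "cut \<tau> y i = cut \<tau> y' i" for i
    proof -
      have "y i = y' i \<and> h (y i) - 1 = h (y' i) - 1"
      proof (rule CKR_level_unique[OF P])
        show "sh (cut \<tau> y i) (E y) \<in> X" using YD(2)[OF y(1)] by simp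
        show "sh (int (h (y i) - 1)) (sh (cut \<tau> y i) (E y)) \<in> B (y i)" by (rule Y_cell[OF y(1)])
        show "sh (int (h (y' i) - 1)) (sh (cut \<tau> y i) (E y)) \<in> B (y' i)"
          using Y_cell[OF y(2), of i] by (simp add: EE that)
        show "y i \<in> {1..d}" "y' i \<in> {1..d}" using YD(1) y by blast+
        then show "h (y i) - 1 < h (y i)" "h (y' i) - 1 < h (y' i)" using BD(3) by fastforce+
      qed
      then show ?thesis by simp
    qed
    \<comment> \<open>Rightwards, a common cut shows the farthest level of the tower that starts
      there, which identifies it. Leftwards, the coordinate just before the cut is the base of the
      preceding tower, which identifies that one.\<close>
    have "cut \<tau> y i = cut \<tau> y' i" for i
    proof (induction i rule: int_induct[where k = 0])
      case (step1 i) then show ?case using same[of i] by (simp add: cut_step)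
    next
      case (step2 i)
      have "y (i - 1) = y' (i - 1) \<and> 0 = (0::nat)"
      proof (rule CKR_level_unique[OF P])
        show "sh (cut \<tau> y i - 1) (E y) \<in> X" using YD(2)[OF y(1)] by simp
        show "sh (int 0) (sh (cut \<tau> y i - 1) (E y)) \<in> B (y (i - 1))"
          using YD(3)[OF y(1), of "i - 1"] by simp
        show "sh (int 0) (sh (cut \<tau> y i - 1) (E y)) \<in> B (y' (i - 1))"
          using YD(3)[OF y(2), of "i - 1"] step2 by (simp add: EE)
        show "y (i - 1) \<in> {1..d}" "y' (i - 1) \<in> {1..d}" using YD(1) y by blast+
        then show "0 < h (y (i - 1))" "0 < h (y' (i - 1))" using BD(3) by fastforce+
      qed
      then show ?case
        using step2 cut_step[of \<tau> y "i - 1"] cut_step[of \<tau> y' "i - 1"] by simp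
    qed (simp add: cut_0)
    then show "k = k' \<and> y = y'" using kk same by blast
  qed
  moreover have "smallest_subshift A (morphism_ext \<tau> ` Y) X"
  proof -
    define lab where "lab z = (SOME k. k \<in> {1..d} \<and> z \<in> B k)" for z
    define prev where "prev z = sh (- int (h (lab z))) z" for z
    have baseX: "base d B \<subseteq> X" unfolding base_def using BD(4) by blast
    have lab: "lab z \<in> {1..d}" "z \<in> B (lab z)" if "z \<in> base d B" for z
    proof -
      have "\<exists>k. k \<in> {1..d} \<and> z \<in> B k" using that by (auto simp: base_def)
      from someI_ex[OF this] show "lab z \<in> {1..d}" "z \<in> B (lab z)" by (simp_all add: lab_def)
    qed
    have lab_eq: "lab z = k" if k: "k \<in> {1..d}" "z \<in> B k" for z k
    proof -
      have z: "z \<in> base d B" using k by (auto simp: base_def)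
      have "lab z = k \<and> 0 = (0::nat)"
      proof (rule CKR_level_unique[OF P])
        show "z \<in> X" using BD(4) k by blast
        show "0 < h (lab z)" "0 < h k" using BD(3)[OF k(1)] BD(3)[OF lab(1)[OF z]] by simp_all
      qed (use k lab[OF z] in auto)
      then show ?thesis by simp
    qed
    have ret: "(\<Union>k\<in>{1..d}. {x \<in> X. sh (int (h k)) x \<in> B k}) = base d B"
      using P unfolding CKR_partition_def preim_eq by blast
    have "\<exists>q :: int \<Rightarrow> int \<Rightarrow> 'a. \<forall>i. q i \<in> base d B \<and> q i = prev (q (i + 1))"
    proof (rule int_orbit)
      obtain x where x: "x \<in> X" using infinite_X by fastforce
      then obtain k where "k \<in> {1..d}"
        using CKR_partition_on[OF P] by (auto simp: partition_on_def atoms_def levels_def)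
      then have "\<exists>z. z \<in> B k" using bottom_ex by (auto simp: bottom_def)
      then show "base d B \<noteq> {}" using \<open>k \<in> {1..d}\<close> by (auto simp: base_def)
    next
      fix z assume z: "z \<in> base d B"
      have "prev z \<in> X" using z baseX by (auto simp: prev_def)
      moreover have "sh (int (h (lab z))) (prev z) \<in> B (lab z)" using lab[OF z] by (simp add: prev_def)
      ultimately show "prev z \<in> base d B" using ret lab(1)[OF z] by blast
    next
      fix z assume "z \<in> base d B"
      then obtain k where k: "k \<in> {1..d}" "sh (int (h k)) z \<in> B k" using ret by blast
      then have "prev (sh (int (h k)) z) = z" by (simp add: prev_def lab_eq)
      moreover have "sh (int (h k)) z \<in> base d B" using k by (auto simp: base_def)
      ultimately show "\<exists>w\<in>base d B. prev w = z" by blast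
    qed
    then obtain q :: "int \<Rightarrow> int \<Rightarrow> 'a" where q: "\<And>i. q i \<in> base d B" "\<And>i. q i = prev (q (i + 1))"
      by blast
    define y where "y i = lab (q (i + 1))" for i
    have yL: "y i \<in> {1..d}" for i unfolding y_def by (rule lab[OF q(1)])
    have q_step: "q (i + 1) = sh (int (h (y i))) (q i)" for i
      unfolding q(2)[of i] by (simp add: prev_def y_def)
    have q_cut: "q i = sh (cut \<tau> y i) (q 0)" for i
    proof (induction i rule: int_induct[where k = 0])
      case (step1 i)
      then show ?case using q_step[of i] cut_step[of \<tau> y i] by (simp add: len add.commute)
    next
      case (step2 i)
      have "sh (int (h (y (i - 1)))) (q (i - 1)) = sh (cut \<tau> y i) (q 0)"
        using q_step[of "i - 1"] step2 by simp
      also have "\<dots> = sh (int (h (y (i - 1)))) (sh (cut \<tau> y (i - 1)) (q 0))"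
        using cut_step[of \<tau> y "i - 1"] by (simp add: len add.commute)
      finally show ?case unfolding sh_eq_iff .
    qed (simp add: cut_0)
    \<comment> \<open>\<open>q 0\<close> lies in the base, the last level of a tower, so the next
      tower starts one step later; this puts the cut 0 at coordinate 0.\<close>
    define x where "x = sh 1 (q 0)"
    have xX: "x \<in> X" using q(1) baseX by (auto simp: x_def)
    have x_top: "sh (cut \<tau> y (i + 1) - 1) x \<in> B (y i)" for i
      using lab(2)[OF q(1), of "i + 1"] q_cut[of "i + 1"] by (simp add: x_def y_def)
    have "E y = x"
    proof
      fix j
      obtain n where n: "cut \<tau> y n \<le> j" "j < cut \<tau> y (n + 1)"
        using cut_cover[of \<tau> y j] \<tau>_ne[OF yL] by blast
      have "int (h (y n) - 1) + cut \<tau> y n = cut \<tau> y (n + 1) - 1"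
        using BD(3)[OF yL] by (simp add: cut_step len of_nat_diff)
      then have "bottom (y n) (sh (cut \<tau> y n) x)" using x_top[of n] xX by (simp add: bottom_def)
      then have "\<tau> (y n) = factor (sh (cut \<tau> y n) x) 0 (h (y n))" using \<tau>[OF yL] by simp
      moreover have "nat (j - cut \<tau> y n) < h (y n)" using n by (simp add: cut_step len)
      ultimately have "\<tau> (y n) ! nat (j - cut \<tau> y n) = x j" using n by (simp add: factor_def sh_apply)
      then show "E y j = x j" unfolding E_def using morphism_ext_at[of \<tau> y n j] n \<tau>_ne[OF yL] by simp
    qed
    then have y: "y \<in> Y" unfolding Y_def using yL xX x_top by simp
    have "X \<subseteq> X'" if X': "subshift A X'" "morphism_ext \<tau> ` Y \<subseteq> X'" for X'
    proof -
      interpret X': shift_space A X' by unfold_locales (rule X'(1))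
      have "X \<inter> X' = X"
      proof (rule minimalD)
        show "closedin XT (X \<inter> X')" using X'.closedin_X by (rule closedin_subtopology_Int_closed)
        show "X \<inter> X' \<noteq> {}" using y X'(2) YD(2)[OF y] unfolding E_def by blast
      qed auto
      then show ?thesis by blast
    qed
    then show ?thesis using subshift YD(2) unfolding smallest_subshift_def E_def by blast
  qed
  moreover have words: "\<tau> ` {1..d} \<subseteq> (\<Union>k\<in>{1..d}. words (h k) X)"
  proof -
    have "\<tau> k \<in> words (h k) X" if k: "k \<in> {1..d}" for k
    proof -
      obtain x where x: "bottom k x" using bottom_ex[OF k] by blast
      then have "\<tau> k = factor x 0 (h k)" "x \<in> X" using \<tau>[OF k x] by (simp_all add: bottom_def)
      then show ?thesis unfolding words_def by blast
    qed
    then show ?thesis by blast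
  qed
  moreover have "\<tau> ` {1..d} \<subseteq> lists A"
  proof -
    have "words m X \<subseteq> lists A" for m using X_A by (auto simp: words_def factor_def)
    then show ?thesis using words by blast
  qed
  moreover have "[] \<notin> \<tau> ` {1..d}" using \<tau>_ne by (metis imageE)
  moreover have "card (\<tau> ` {1..d}) \<le> d" using card_image_le[of "{1..d}" \<tau>] by simp
  ultimately show ?thesis
    unfolding recognizable_words_def by (intro exI[of _ "\<tau> ` {1..d}"]) blast
qed

section \<open>Heights and atoms in a nested sequence of partitions\<close>

context
  fixes d B h
  assumes nested: "nested_CKR XT shift d B h"
begin

lemma nested_CKR: "CKR_partition XT shift (d n) (B n) (h n)"
  by (rule nested[unfolded nested_CKR_def, THEN conjunct1, THEN spec])

lemmas nested_base_Suc =
    nested[unfolded nested_CKR_def, THEN conjunct2, THEN conjunct2, THEN conjunct1, THEN spec]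
  and nested_refines_Suc =
    nested[unfolded nested_CKR_def, THEN conjunct2, THEN conjunct2, THEN conjunct2, THEN conjunct1,
      THEN spec, THEN bspec]
  and nested_point =
    nested[unfolded nested_CKR_def, THEN conjunct2, THEN conjunct2, THEN conjunct2, THEN conjunct2,
      THEN conjunct1]
  and nested_topology =
    nested[unfolded nested_CKR_def, THEN conjunct2, THEN conjunct2, THEN conjunct2, THEN conjunct2,
      THEN conjunct2]

lemma nested_base_mono: "m \<le> n \<Longrightarrow> base (d n) (B n) \<subseteq> base (d m) (B m)"
proof (induction n rule: dec_induct)
  case (step n)
  then show ?case using nested_base_Suc[of n] by blast
qed simp

lemma nested_refines:
  assumes "m \<le> n" "P \<in> atoms XT shift (d n) (B n) (h n)"
  shows "\<exists>Q\<in>atoms XT shift (d m) (B m) (h m). P \<subseteq> Q"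
  using assms
proof (induction n arbitrary: P rule: dec_induct)
  case base then show ?case by blast
next
  case (step n)
  obtain Q where "Q \<in> atoms XT shift (d n) (B n) (h n)" "P \<subseteq> Q"
    using nested_refines_Suc[OF step.prems] by blast
  then show ?case using step.IH[of Q] by blast
qed

text \<open>Generating the topology makes the atoms a subbasis only. Refinement upgrades this to a
  basis: the atom of the finer of two levels that contains \<open>x\<close> lies in both given
  atoms.\<close>

lemma nested_basis:
  assumes "openin XT V" "x \<in> V"
  shows "\<exists>n. \<exists>Q\<in>atoms XT shift (d n) (B n) (h n). x \<in> Q \<and> Q \<subseteq> V"
proof -
  have "generate_topology_on (\<Union>n. atoms XT shift (d n) (B n) (h n)) V"
    using assms(1) unfolding openin_topology_generated_by_iff[symmetric] nested_topology .
  then show ?thesis using assms(2)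
  proof (induction arbitrary: x rule: generate_topology_on.induct)
    case (Int V1 V2)
    from Int.IH(1)[of x] Int.prems obtain n1 Q1
      where 1: "Q1 \<in> atoms XT shift (d n1) (B n1) (h n1)" "x \<in> Q1" "Q1 \<subseteq> V1" by blast
    from Int.IH(2)[of x] Int.prems obtain n2 Q2
      where 2: "Q2 \<in> atoms XT shift (d n2) (B n2) (h n2)" "x \<in> Q2" "Q2 \<subseteq> V2" by blast
    have part: "partition_on X (atoms XT shift (d n) (B n) (h n))" for n
      using nested_CKR by (rule CKR_partition_on)
    have "x \<in> X" using part[of n1] 1 by (auto simp: partition_on_def)
    then obtain Q where Q: "Q \<in> atoms XT shift (d (max n1 n2)) (B (max n1 n2)) (h (max n1 n2))" "x \<in> Q"
      using part[of "max n1 n2"] by (auto simp: partition_on_def)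
    have sub: "Q \<subseteq> Q'" if n: "n \<le> max n1 n2" and Q': "Q' \<in> atoms XT shift (d n) (B n) (h n)" "x \<in> Q'" for n Q'
    proof -
      obtain Q'' where "Q'' \<in> atoms XT shift (d n) (B n) (h n)" "Q \<subseteq> Q''"
        using nested_refines[OF n Q(1)] by blast
      moreover have "Q'' = Q'"
        using calculation Q' Q(2) partition_onD2[OF part[of n]] by (auto simp: disjoint_def)
      ultimately show ?thesis by simp
    qed
    have "Q \<subseteq> V1 \<inter> V2" using sub[OF _ 1(1,2)] sub[OF _ 2(1,2)] 1(3) 2(3) by fastforce
    then show ?case using Q by blast
  next
    case (UN K)
    then obtain k where k: "k \<in> K" "x \<in> k" by blast
    then show ?case using UN.IH[of k x] by blast
  next
    case (Basis s)
    then show ?case by blast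
  qed blast
qed

text \<open>\<open>F n\<close> is the union of the atoms of level \<open>n\<close> on which
  coordinate 0 varies. It is closed and decreases by refinement. No point stays in it, since some
  atom around the point fits into the clopen set fixing coordinate 0; compactness empties it at a
  finite level.\<close>

lemma nested_constant:
  "\<exists>N. \<forall>n\<ge>N. \<forall>Q\<in>atoms XT shift (d n) (B n) (h n). \<forall>x\<in>Q. \<forall>y\<in>Q. x 0 = y 0"
proof -
  let ?at = "\<lambda>n. atoms XT shift (d n) (B n) (h n)"
  define F where "F n = \<Union> {Q \<in> ?at n. \<exists>x\<in>Q. \<exists>y\<in>Q. x 0 \<noteq> y 0}" for n
  have sub: "F n \<subseteq> F m" if mn: "m \<le> n" for m n
  proof
    fix z assume "z \<in> F n"
    then obtain Q x y where Q: "Q \<in> ?at n" "z \<in> Q" "x \<in> Q" "y \<in> Q" "x 0 \<noteq> y 0"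
      unfolding F_def by blast
    obtain Q' where "Q' \<in> ?at m" "Q \<subseteq> Q'" using nested_refines[OF mn Q(1)] by blast
    then show "z \<in> F m" using Q unfolding F_def by blast
  qed
  have "closedin XT (F n)" for n
    unfolding F_def
  proof (rule closedin_Union)
    have "finite (?at n)" by (simp add: atoms_def finite_levels)
    then show "finite {Q \<in> ?at n. \<exists>x\<in>Q. \<exists>y\<in>Q. x 0 \<noteq> y 0}" by simp
  qed (use CKR_atom_clopen(2)[OF nested_CKR] in blast)
  moreover have "F (Suc n) \<subseteq> F n" for n by (rule sub) simp
  moreover have "(\<Inter>n. F n) = {}"
  proof -
    have "\<exists>n. x \<notin> F n" for x
    proof (cases "x \<in> X")
      case True
      define V where "V = {y \<in> X. y 0 = x 0}"
      have "window X 0 V" unfolding V_def window_def agree_def by auto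
      then have "openin XT V" by (rule window_imp_clopen)
      moreover have "x \<in> V" using True by (simp add: V_def)
      ultimately obtain n Q where Q: "Q \<in> ?at n" "x \<in> Q" "Q \<subseteq> V" using nested_basis by blast
      have "x \<notin> F n"
      proof
        assume "x \<in> F n"
        then obtain Q' y z where Q': "Q' \<in> ?at n" "x \<in> Q'" "y \<in> Q'" "z \<in> Q'" "y 0 \<noteq> z 0"
          unfolding F_def by blast
        then have "Q' = Q"
          using Q(1,2) partition_onD2[OF CKR_partition_on[OF nested_CKR[of n]]] by (auto simp: disjoint_def)
        then have "y \<in> V" "z \<in> V" using Q' Q(3) by blast+
        then show False using Q'(5) by (simp add: V_def)
      qed
      then show ?thesis by blast
    next
      case False
      have "F 0 \<subseteq> X" using \<open>closedin XT (F 0)\<close> closedin_subset by fastforce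
      then show ?thesis using False by blast
    qed
    then show ?thesis by blast
  qed
  ultimately obtain N where N: "F N = {}" using nest[of F] by blast
  have "x 0 = y 0" if "N \<le> n" "Q \<in> ?at n" "x \<in> Q" "y \<in> Q" for n Q x y
  proof -
    have "F n = {}" using sub[OF that(1)] N by blast
    then show ?thesis using that(2-4) unfolding F_def by blast
  qed
  then show ?thesis by blast
qed

text \<open>A tower of height \<open>t\<close> yields a base point that is again in the base after
  time \<open>t\<close>. If such points existed at every level, compactness would give one lying in
  all bases together with its translate. Both would be the single common point \<open>x0\<close>,
  contradicting aperiodicity.\<close>

lemma nested_height_neq:
  assumes "0 < t"
  shows "\<exists>N. \<forall>n\<ge>N. \<forall>k\<in>{1..d n}. h n k \<noteq> t"
proof -
  let ?D = "\<lambda>n. base (d n) (B n)"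
  define F where "F n = {x \<in> ?D n. sh (int t) x \<in> ?D n}" for n
  obtain x0 where x0: "(\<Inter>n. ?D n) = {x0}" using nested_point by blast
  have sub: "F n \<subseteq> F m" if "m \<le> n" for m n
    unfolding F_def using nested_base_mono[OF that] by blast
  have DX: "?D n \<subseteq> X" for n using CKR_base_clopen(1)[OF nested_CKR] openin_subset by fastforce
  have "closedin XT (F n)" for n
  proof -
    obtain m where m: "window X m (?D n)" using CKR_window[OF nested_CKR] by blast
    have "closedin XT {x \<in> X. sh (int t) x \<in> ?D n}"
      by (rule window_imp_clopen(2)[OF window_preimage[OF m]])
    then have "closedin XT (?D n \<inter> {x \<in> X. sh (int t) x \<in> ?D n})"
      using CKR_base_clopen[OF nested_CKR] by blast
    moreover have "?D n \<inter> {x \<in> X. sh (int t) x \<in> ?D n} = F n" using DX by (auto simp: F_def)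
    ultimately show ?thesis by simp
  qed
  moreover have "F (Suc n) \<subseteq> F n" for n by (rule sub) simp
  moreover have "(\<Inter>n. F n) = {}"
  proof (rule ccontr)
    assume "(\<Inter>n. F n) \<noteq> {}"
    then obtain x where "\<And>n. x \<in> F n" by blast
    then have "x \<in> (\<Inter>n. ?D n)" "sh (int t) x \<in> (\<Inter>n. ?D n)" by (auto simp: F_def)
    then have "sh (int t) x = x" "x \<in> X" using x0 DX by auto
    then show False using aperiodic assms by blast
  qed
  ultimately obtain N where N: "F N = {}" using nest[of F] by blast
  have False if n: "N \<le> n" and k: "k \<in> {1..d n}" "h n k = t" for n k
  proof -
    have "(k, 0) \<in> levels (d n) (h n)" using k assms by (simp add: levels_def)
    then have "preim XT shift 0 (B n k) \<in> atoms XT shift (d n) (B n) (h n)" by (force simp: atoms_def)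
    then have "preim XT shift 0 (B n k) \<noteq> {}"
      using CKR_partition_on[OF nested_CKR[of n]] by (auto simp: partition_on_def)
    then obtain z where z: "z \<in> X" "z \<in> B n k" by (auto simp: preim_eq)
    then have zD: "z \<in> ?D n" using k by (auto simp: base_def)
    have "(\<Union>k\<in>{1..d n}. preim XT shift (h n k) (B n k)) = ?D n"
      using nested_CKR[of n] by (simp add: CKR_partition_def)
    moreover have "sh (- int t) z \<in> preim XT shift (h n k) (B n k)" using z k by (simp add: preim_eq)
    ultimately have "sh (- int t) z \<in> ?D n" using k by blast
    then have "sh (- int t) z \<in> F n" using zD by (simp add: F_def)
    then show False using sub[OF n] N by blast
  qed
  then show ?thesis by blast
qed

text \<open>The values below \<open>m\<close> are excluded one at a time, each from some level
  on.\<close>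

lemma nested_heights: "\<exists>N. \<forall>n\<ge>N. \<forall>k\<in>{1..d n}. m \<le> h n k"
proof (induction m)
  case (Suc m)
  then obtain N where N: "\<forall>n\<ge>N. \<forall>k\<in>{1..d n}. m \<le> h n k" by blast
  show ?case
  proof (cases "m = 0")
    case True
    have "Suc 0 \<le> h n k" if "k \<in> {1..d n}" for n k using CKR_baseD(3)[OF nested_CKR that] by simp
    then show ?thesis using True by blast
  next
    case False
    then obtain N' where N': "\<forall>n\<ge>N'. \<forall>k\<in>{1..d n}. h n k \<noteq> m" using nested_height_neq by blast
    have "Suc m \<le> h n k" if n: "max N N' \<le> n" and k: "k \<in> {1..d n}" for n k
    proof -
      have "m \<le> h n k" using N n k by simp
      moreover have "h n k \<noteq> m" using N' n k by simp
      ultimately show ?thesis by simp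
    qed
    then show ?thesis by blast
  qed
qed simp

lemma nested_K_inf_le:
  assumes "\<And>n. d n \<le> r"
  shows "K_inf A X m \<le> enat r"
proof -
  obtain N1 where N1: "\<forall>n\<ge>N1. \<forall>Q\<in>atoms XT shift (d n) (B n) (h n). \<forall>x\<in>Q. \<forall>y\<in>Q. x 0 = y 0"
    using nested_constant by blast
  obtain N2 where N2: "\<forall>n\<ge>N2. \<forall>k\<in>{1..d n}. m \<le> h n k" using nested_heights by blast
  define n where "n = max N1 N2"
  have "\<exists>W. finite W \<and> card W \<le> d n \<and> recognizable_words A X W \<and>
      W \<subseteq> (\<Union>k\<in>{1..d n}. words (h n k) X)"
  proof (rule CKR_imp_recognizable_words[OF nested_CKR])
    fix Q x y assume "Q \<in> atoms XT shift (d n) (B n) (h n)" "x \<in> Q" "y \<in> Q"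
    moreover have "N1 \<le> n" by (simp add: n_def)
    ultimately show "x 0 = y 0" using N1 by blast
  qed
  then obtain W where W: "finite W" "card W \<le> d n" "recognizable_words A X W"
    "W \<subseteq> (\<Union>k\<in>{1..d n}. words (h n k) X)"
    by blast
  have "words (h n k) X \<subseteq> (\<Union>k\<in>{m..}. words k X)" if "k \<in> {1..d n}" for k
  proof -
    have "N2 \<le> n" by (simp add: n_def)
    then have "m \<le> h n k" using N2 that by blast
    then show ?thesis by auto
  qed
  then have "(\<Union>k\<in>{1..d n}. words (h n k) X) \<subseteq> (\<Union>k\<in>{m..}. words k X)" by (rule UN_least)
  then have "W \<subseteq> (\<Union>k\<in>{m..}. words k X)" using W(4) by (rule order_trans[rotated])
  then have "K_inf A X m \<le> enat (card W)"
    unfolding K_inf_def using W by (intro INF_lower) simp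
  also have "\<dots> \<le> enat r" using W(2) assms[of n] by simp
  finally show ?thesis .
qed

end

lemma finite_rank_imp_finite_K:
  assumes "finite_topological_rank XT shift"
  shows "K A X < \<infinity>"
proof -
  obtain r d B h where "nested_CKR XT shift d B h" "\<And>n. d n \<le> r"
    using assms unfolding finite_topological_rank_def topological_rank_le_def by blast
  then have "K_inf A X m \<le> enat r" for m by (rule nested_K_inf_le)
  then have "K A X \<le> enat r" by (intro LIMSEQ_le_const2[OF K_inf_LIMSEQ]) blast
  then show ?thesis using enat_ord_simps(4) order_le_less_trans by blast
qed

end

theorem theorem4p4:
  fixes A :: "'a set" and X :: "(int \<Rightarrow> 'a) set"
  assumes "minimal_subshift A X" and "infinite X"
  shows "finite_topological_rank (subtopology (full_shift A) X) shift \<longleftrightarrow> K A X < \<infinity>"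
proof -
  interpret infinite_minimal A X using assms by unfold_locales
  show ?thesis using finite_rank_imp_finite_K finite_K_imp_finite_rank by blast
qed

end
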